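(* Let $$\mathcal{F}^*:=\min\Big\{\int_{-1}^1\Big|\frac{du}{dx}\Big|^2dx:\ u\in W^{1,2}(-1,1),\ \int_{-1}^1u^2\,dx=1,\ \int_{-1}^1u\,dx=0\Big\},$$ and let $$\mathcal{F}_{\rm omr}:=\min_{(\mu,\nu)\in\mathbb{O}^2}\int z^2\,d\mu(x,y,z)$$ be its occupation measure relaxation, with $\mathbb{O}^2$ as defined in the context. Then $\mathcal{F}^*=\dfrac{\pi^2}{4}$ but $\mathcal{F}_{\rm omr}=0$.
   Context: $\Phi^2$ is the vector space of real-valued $\phi\in C^1([-1,1]\times\mathbb{R})$ for which there is a constant $C$ with $|\partial_y\phi(x,y)|\le C(1+|y|)$ and $|\phi(x,y)|+|\partial_x\phi(x,y)|\le C(1+|y|^2)$. For $\phi\in\Phi^2$, $\mathcal{D}\phi(x,y,z):=\partial_x\phi(x,y)+\partial_y\phi(x,y)\,z$. $\mathbb{O}^2$ is the set of pairs $(\mu,\nu)$ of nonnegative Radon measures, $\mu$ on $[-1,1]\times\mathbb{R}\times\mathbb{R}$ and $\nu$ on $\{-1,1\}\times\mathbb{R}$, with $\int(1+|y|^2+|z|^2)\,d\mu<\infty$ and $\int(1+|y|^2)\,d\nu<\infty$, such that (i) $\int y\,d\mu=0$ and $\int y^2\,d\mu=1$; (ii) $\int h(x)\,d\mu(x,y,z)=\int_{-1}^1h(x)\,dx$ for all $h\in C([-1,1])$; (iii) $\int\ell(x)\,d\nu(x,y)=\ell(-1)+\ell(1)$ for all functions $\ell:\{-1,1\}\to\mathbb{R}$;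 (iv) $\int\mathcal{D}\phi\,d\mu-\int x\,\phi(x,y)\,d\nu(x,y)=0$ for all $\phi\in\Phi^2$ (the outward normal of $(-1,1)$ at $x=\pm1$ is $\hat n(x)=x$). *)

theory Defs
  imports "HOL-Analysis.Analysis"
begin

definition is_minimum :: "real set \<Rightarrow> real \<Rightarrow> bool" where
  "is_minimum V m \<longleftrightarrow> m \<in> V \<and> (\<forall>v\<in>V. m \<le> v)"


subsection \<open>The Sobolev space $W^{1,2}$ on an open set of reals\<close>

definition L2_on :: "real set \<Rightarrow> (real \<Rightarrow> real) set" where
  "L2_on S = {u \<in> borel_measurable (lebesgue_on S). integrable (lebesgue_on S) (\<lambda>x. (u x)\<^sup>2)}"

definition test_functions :: "real set \<Rightarrow> (real \<Rightarrow> real) set" where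
  "test_functions S = {\<phi>. (\<forall>n. (deriv ^^ n) \<phi> differentiable_on UNIV) \<and>
     compact (closure {x. \<phi> x \<noteq> 0}) \<and> closure {x. \<phi> x \<noteq> 0} \<subseteq> S}"

definition has_weak_derivative_on :: "(real \<Rightarrow> real) \<Rightarrow> (real \<Rightarrow> real) \<Rightarrow> real set \<Rightarrow> bool" where
  "has_weak_derivative_on u u' S \<longleftrightarrow> (\<forall>\<phi>\<in>test_functions S.
     (LINT x|lebesgue_on S. u x * deriv \<phi> x) = - (LINT x|lebesgue_on S. u' x * \<phi> x))"

text \<open>
  The pairs of a function \<open>u\<close> in $W^{1,2}(S)$ and a representative \<open>u'\<close> of its weak derivative,
  which is unique up to null sets.
\<close>

definition W12_with_derivative :: "real set \<Rightarrow> ((real \<Rightarrow> real) \<times> (real \<Rightarrow> real)) set" where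
  "W12_with_derivative S =
     {(u, u'). u \<in> L2_on S \<and> u' \<in> L2_on S \<and> has_weak_derivative_on u u' S}"


subsection \<open>The test space on the strip\<close>

text \<open>
  At \<open>x = -1\<close> and \<open>x = 1\<close> the derivative in \<open>x\<close> is one-sided, so that everything below depends only
  on the values of \<open>\<phi>\<close> on the closed strip.
\<close>

definition partial_x :: "(real \<Rightarrow> real \<Rightarrow> real) \<Rightarrow> real \<Rightarrow> real \<Rightarrow> real" where
  "partial_x \<phi> x y = vector_derivative (\<lambda>s. \<phi> s y) (at x within {-1..1})"

definition partial_y :: "(real \<Rightarrow> real \<Rightarrow> real) \<Rightarrow> real \<Rightarrow> real \<Rightarrow> real" where
  "partial_y \<phi> x y = deriv (\<lambda>t. \<phi> x t) y"

definition C1_strip :: "(real \<Rightarrow> real \<Rightarrow> real) set" where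
  "C1_strip = {\<phi>.
     (\<forall>x\<in>{-1..1}. \<forall>y. (\<lambda>s. \<phi> s y) differentiable (at x within {-1..1}) \<and>
                      (\<lambda>t. \<phi> x t) differentiable (at y)) \<and>
     continuous_on ({-1..1} \<times> UNIV) (\<lambda>(x, y). \<phi> x y) \<and>
     continuous_on ({-1..1} \<times> UNIV) (\<lambda>(x, y). partial_x \<phi> x y) \<and>
     continuous_on ({-1..1} \<times> UNIV) (\<lambda>(x, y). partial_y \<phi> x y)}"

definition Phi2 :: "(real \<Rightarrow> real \<Rightarrow> real) set" where
  "Phi2 = {\<phi> \<in> C1_strip. \<exists>C. \<forall>x\<in>{-1..1}. \<forall>y.
     \<bar>partial_y \<phi> x y\<bar> \<le> C * (1 + \<bar>y\<bar>) \<and>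
     \<bar>\<phi> x y\<bar> + \<bar>partial_x \<phi> x y\<bar> \<le> C * (1 + \<bar>y\<bar>\<^sup>2)}"

definition total_derivative :: "(real \<Rightarrow> real \<Rightarrow> real) \<Rightarrow> real \<Rightarrow> real \<Rightarrow> real \<Rightarrow> real" where
  "total_derivative \<phi> x y z = partial_x \<phi> x y + partial_y \<phi> x y * z"


subsection \<open>Relaxed occupation measures\<close>

text \<open>
  Nonnegative Radon measures on \<open>S\<close>: Borel measures with \<open>S\<close> as their space that are finite on
  compact sets and inner regular. For a closed \<open>S\<close> this agrees with the usual notion on a locally
  compact space.
\<close>

definition radon_measure_on :: "'a::topological_space set \<Rightarrow> 'a measure \<Rightarrow> bool" where
  "radon_measure_on S M \<longleftrightarrow> sets M = sets (restrict_space borel S) \<and>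
     (\<forall>K. compact K \<and> K \<subseteq> S \<longrightarrow> emeasure M K < \<infinity>) \<and>
     (\<forall>A\<in>sets M. emeasure M A = (SUP K\<in>{K. K \<subseteq> A \<and> compact K}. emeasure M K))"

text \<open>
  The two integrability conditions are the moment bounds. They make every integrand below
  integrable, so the Bochner integral never takes its default value.
\<close>

definition O2 :: "((real \<times> real \<times> real) measure \<times> (real \<times> real) measure) set" where
  "O2 = {(\<mu>, \<nu>).
     radon_measure_on ({-1..1} \<times> UNIV \<times> UNIV) \<mu> \<and>
     radon_measure_on ({-1, 1} \<times> UNIV) \<nu> \<and>
     integrable \<mu> (\<lambda>(x, y, z). 1 + \<bar>y\<bar>\<^sup>2 + \<bar>z\<bar>\<^sup>2) \<and>
     integrable \<nu> (\<lambda>(x, y). 1 + \<bar>y\<bar>\<^sup>2) \<and>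
     (LINT (x, y, z)|\<mu>. y) = 0 \<and>
     (LINT (x, y, z)|\<mu>. y\<^sup>2) = 1 \<and>
     (\<forall>h::real \<Rightarrow> real. continuous_on {-1..1} h \<longrightarrow> (LINT (x, y, z)|\<mu>. h x) = integral {-1..1} h) \<and>
     (\<forall>l::real \<Rightarrow> real. (LINT (x, y)|\<nu>. l x) = l (-1) + l 1) \<and>
     (\<forall>\<phi>\<in>Phi2. (LINT (x, y, z)|\<mu>. total_derivative \<phi> x y z) - (LINT (x, y)|\<nu>. x * \<phi> x y) = 0)}"

end

theory Submission
  imports Defs
begin

text \<open>
  The two problems behave differently because the constraints on mean and norm are nonlocal. The
  relaxed problem only sees them through integrals against \<open>\<mu>\<close>, so they need not hold for each of
  the graphs that \<open>\<mu>\<close> superposes. The constant functions \<open>1 / sqrt 2\<close> and \<open>- 1 / sqrt 2\<close> have norm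
  one and no gradient, but not mean zero; the average of their two occupation measures satisfies all
  the constraints and has energy zero (\<open>superposed_in_O2\<close>).

  For functions the value is governed by the sharp Wirtinger inequality
  \<open>Wirtinger_inequality\<close>, with equality for \<open>sin (pi * x / 2)\<close>. A function in $W^{1,2}$ is, up to a
  constant, the primitive of its weak derivative (\<open>weakly_differentiable_eq_midpoint_primitive\<close>, by
  the lemma of du Bois-Reymond). Written from the midpoint, this primitive is the integral of
  \<open>u' t\<close> against the kernel \<open>oriented t s\<close>, which is \<open>1\<close> for \<open>0 \<le> t < s\<close>, \<open>-1\<close> for
  \<open>s < t < 0\<close> and zero otherwise. If \<open>u\<close> has mean zero, the constant drops out of the integral of
  \<open>u * u\<close>, which becomes the double integral of \<open>oriented t s * u' t * u s\<close>. The absolute value of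
  the kernel exchanges the weights \<open>cos (pi * t / 2)\<close> and \<open>\<bar>sin (pi * s / 2)\<bar>\<close> up to the factor
  \<open>2 / pi\<close>. The arithmetic-geometric mean inequality with these weights, as in Schur's test, bounds
  the double integral by the mean of \<open>(2 / pi)\<^sup>2\<close> times the energy and the squared norm
  (\<open>oriented_Schur_bound\<close>). The double integral is the squared norm itself, so half of it can be
  absorbed, and the inequality follows.
\<close>

section \<open>Smooth functions and bump functions\<close>

definition smooth :: "(real \<Rightarrow> real) \<Rightarrow> bool" where
  "smooth f \<longleftrightarrow> (\<forall>n. (deriv ^^ n) f differentiable_on UNIV)"

lemma smooth_iff: "smooth f \<longleftrightarrow> f differentiable_on UNIV \<and> smooth (deriv f)"
proof -
  have "smooth f \<longleftrightarrow> (deriv ^^ 0) f differentiable_on UNIV \<and> (\<forall>n. (deriv ^^ Suc n) f differentiable_on UNIV)"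
    unfolding smooth_def by (metis nat.exhaust)
  also have "\<dots> \<longleftrightarrow> f differentiable_on UNIV \<and> smooth (deriv f)"
    unfolding smooth_def funpow_Suc_right by simp
  finally show ?thesis .
qed

lemma smooth_has_derivative: "smooth f \<Longrightarrow> (f has_real_derivative deriv f x) (at x)"
  unfolding smooth_iff[of f] differentiable_on_def
  by (simp add: DERIV_deriv_iff_real_differentiable)

lemma smooth_deriv: "smooth f \<Longrightarrow> smooth (deriv f)"
  using smooth_iff by blast

lemma smooth_continuous_on: "smooth f \<Longrightarrow> continuous_on S f"
  by (meson smooth_iff continuous_on_subset differentiable_imp_continuous_on subset_UNIV)

text \<open>
  Closure properties are proved by exhibiting a set of functions that is closed under
  differentiation; this avoids formulas for higher derivatives.
\<close>

lemma smooth_coinduct: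
  assumes "f \<in> C" and C: "\<And>g. g \<in> C \<Longrightarrow> \<exists>g'\<in>C. \<forall>x. (g has_real_derivative g' x) (at x)"
  shows "smooth f"
proof -
  have d: "g differentiable_on UNIV \<and> deriv g \<in> C" if g: "g \<in> C" for g
  proof -
    obtain g' where g': "g' \<in> C" "\<And>x. (g has_real_derivative g' x) (at x)" using C[OF g] by blast
    have "deriv g = g'" using DERIV_imp_deriv[OF g'(2)] by blast
    then show ?thesis
      using g' by (auto simp: differentiable_on_def real_differentiable_def)
  qed
  have "(deriv ^^ n) f \<in> C" for n
    by (induction n) (use \<open>f \<in> C\<close> d in auto)
  then show ?thesis unfolding smooth_def using d by blast
qed

lemma smooth_if_smooth_derivative:
  assumes "\<And>x. (f has_real_derivative f' x) (at x)" and "smooth f'"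
  shows "smooth f"
proof -
  have "deriv f = f'" using DERIV_imp_deriv[OF assms(1)] by blast
  moreover have "f differentiable_on UNIV"
    using assms(1) by (auto simp: differentiable_on_def real_differentiable_def)
  ultimately show ?thesis using assms(2) by (simp add: smooth_iff[of f])
qed

lemma smooth_affine:
  assumes "smooth f" shows "smooth (\<lambda>x. c * f (a * x + b))"
proof (rule smooth_coinduct)
  show "(\<lambda>x. c * f (a * x + b)) \<in> {\<lambda>x. c * g (a * x + b) | c g. smooth g}"
    using assms by blast
next
  fix h assume "h \<in> {\<lambda>x. c * g (a * x + b) | c g. smooth g}"
  then obtain c g where h: "h = (\<lambda>x. c * g (a * x + b))" "smooth g" by blast
  have "(h has_real_derivative (c * a) * deriv g (a * x + b)) (at x)" for x
    unfolding h by (auto intro!: derivative_eq_intros DERIV_chain'[OF _ smooth_has_derivative[OF h(2)]])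
  then show "\<exists>g'\<in>{\<lambda>x. c * g (a * x + b) | c g. smooth g}. \<forall>x. (h has_real_derivative g' x) (at x)"
    using smooth_deriv[OF h(2)] by (intro bexI[of _ "\<lambda>x. (c * a) * deriv g (a * x + b)"]) blast+
qed

text \<open>
  Closing the products under addition makes the set closed under differentiation, by the product
  rule.
\<close>

inductive_set sums_of_smooth_products :: "(real \<Rightarrow> real) set" where
  product: "smooth f \<Longrightarrow> smooth g \<Longrightarrow> (\<lambda>x. f x * g x) \<in> sums_of_smooth_products"
| sum: "h \<in> sums_of_smooth_products \<Longrightarrow> k \<in> sums_of_smooth_products
    \<Longrightarrow> (\<lambda>x. h x + k x) \<in> sums_of_smooth_products"

lemma smooth_sums_of_smooth_products:
  assumes "h \<in> sums_of_smooth_products" shows "smooth h"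
  using assms
proof (rule smooth_coinduct)
  fix g assume "g \<in> sums_of_smooth_products"
  then show "\<exists>g'\<in>sums_of_smooth_products. \<forall>x. (g has_real_derivative g' x) (at x)"
  proof induction
    case (product f g)
    then have "\<forall>x. ((\<lambda>x. f x * g x) has_real_derivative deriv f x * g x + f x * deriv g x) (at x)"
      by (auto intro!: derivative_eq_intros smooth_has_derivative)
    moreover have "(\<lambda>x. deriv f x * g x + f x * deriv g x) \<in> sums_of_smooth_products"
      using product by (intro sums_of_smooth_products.intros smooth_deriv)
    ultimately show ?case by (rule rev_bexI[rotated])
  next
    case (sum h k)
    then obtain h' k' where "h' \<in> sums_of_smooth_products" "k' \<in> sums_of_smooth_products"
      "\<And>x. (h has_real_derivative h' x) (at x)" "\<And>x. (k has_real_derivative k' x) (at x)" by blast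
    then show ?case
      by (intro bexI[of _ "\<lambda>x. h' x + k' x"]) (auto intro!: derivative_intros sums_of_smooth_products.sum)
  qed
qed

lemma smooth_mult: "smooth f \<Longrightarrow> smooth g \<Longrightarrow> smooth (\<lambda>x. f x * g x)"
  by (rule smooth_sums_of_smooth_products[OF sums_of_smooth_products.product])

lemma smooth_const: "smooth (\<lambda>x. c)"
  by (rule smooth_coinduct[where C = "range (\<lambda>c x. c)"])
     (auto intro!: exI[of _ "0::real"] derivative_eq_intros)

lemma smooth_add:
  assumes "smooth f" "smooth g" shows "smooth (\<lambda>x. f x + g x)"
proof -
  have "(\<lambda>x. f x * 1 + g x * 1) \<in> sums_of_smooth_products"
    by (intro sums_of_smooth_products.sum sums_of_smooth_products.product assms smooth_const)
  then show ?thesis by (auto dest: smooth_sums_of_smooth_products)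
qed

lemma smooth_diff: "smooth f \<Longrightarrow> smooth g \<Longrightarrow> smooth (\<lambda>x. f x - g x)"
  using smooth_add[of f "\<lambda>x. -1 * g x"] smooth_mult[OF smooth_const[of "-1"], of g] by simp

lemma poly_times_exp_tendsto_0: "((\<lambda>t::real. poly p t * exp (- t)) \<longlongrightarrow> 0) at_top"
proof -
  have "((\<lambda>t::real. \<Sum>i\<le>degree p. coeff p i * (t ^ i / exp t)) \<longlongrightarrow> (\<Sum>i\<le>degree p. coeff p i * 0)) at_top"
    by (intro tendsto_intros tendsto_power_div_exp_0)
  then show ?thesis
    by (simp add: poly_altdef exp_minus sum_distrib_right divide_inverse mult.assoc)
qed

text \<open>
  The classical function \<open>exp (- (1 / x))\<close>, extended by zero to the left, together with the
  polynomial factors in \<open>1 / x\<close> that its derivatives carry.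
\<close>

definition flat :: "real poly \<Rightarrow> real \<Rightarrow> real" where
  "flat p x = (if x > 0 then poly p (1 / x) * exp (- (1 / x)) else 0)"

lemma flat_has_derivative:
  "(flat p has_real_derivative flat ([:0, 0, 1:] * (p - pderiv p)) x) (at x)"
proof -
  consider "x > 0" | "x < 0" | "x = 0" by linarith
  then show ?thesis
  proof cases
    case 1
    have "((\<lambda>x. poly p (1 / x) * exp (- (1 / x))) has_real_derivative
        flat ([:0, 0, 1:] * (p - pderiv p)) x) (at x)"
      using 1 unfolding flat_def
      by (auto intro!: derivative_eq_intros DERIV_chain'[OF _ poly_DERIV]
               simp: field_simps power2_eq_square)
    moreover have "eventually (\<lambda>y. flat p y = poly p (1 / y) * exp (- (1 / y))) (nhds x)"
      using eventually_nhds_in_open[of "{0<..}" x] 1 by (auto elim!: eventually_mono simp: flat_def)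
    ultimately show ?thesis by (subst DERIV_cong_ev) auto
  next
    case 2
    have "eventually (\<lambda>y. flat p y = 0) (nhds x)"
      using eventually_nhds_in_open[of "{..<0}" x] 2 by (auto elim!: eventually_mono simp: flat_def)
    then show ?thesis using 2 by (subst DERIV_cong_ev[of x x "flat p" "\<lambda>_. 0"]) (auto simp: flat_def)
  next
    case 3
    have "((\<lambda>h. poly (pCons 0 p) (inverse h) * exp (- inverse h)) \<longlongrightarrow> 0) (at_right 0)"
      using filterlim_compose[OF poly_times_exp_tendsto_0 filterlim_inverse_at_top_right] .
    then have "((\<lambda>h. flat p h / h) \<longlongrightarrow> 0) (at_right 0)"
      by (rule Lim_transform_eventually)
         (auto simp: eventually_at_filter flat_def field_simps)
    moreover have "((\<lambda>h. flat p h / h) \<longlongrightarrow> 0) (at_left 0)"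
      by (rule Lim_transform_eventually[OF tendsto_const]) (auto simp: eventually_at_filter flat_def)
    ultimately show ?thesis
      using 3 by (simp add: DERIV_def flat_def[of _ 0] filterlim_split_at)
  qed
qed

lemma smooth_flat: "smooth (flat p)"
  by (rule smooth_coinduct[where C = "range flat"]) (use flat_has_derivative in blast)+

lemma continuous_antiderivative:
  fixes f :: "real \<Rightarrow> real"
  assumes "continuous_on UNIV f"
  obtains F where "\<And>x. (F has_real_derivative f x) (at x)"
  using einterval_antiderivative[of "-\<infinity>" "\<infinity>" f] assms
  by (auto simp: einterval_def has_real_derivative_iff_has_vector_derivative continuous_on_eq_continuous_at)

lemma constant_of_zero_derivative:
  fixes F f :: "real \<Rightarrow> real"
  assumes "\<And>x. (F has_real_derivative f x) (at x)" and "\<And>z. x < z \<Longrightarrow> z < y \<Longrightarrow> f z = 0" and "x \<le> y"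
  shows "F x = F y"
proof (cases "x = y")
  case False
  then have "x < y" using assms(3) by simp
  from MVT2[OF this, of F f] assms(1,2) show ?thesis by auto
qed simp

text \<open>
  Here \<open>H\<close> is a smooth step from \<open>0\<close> to \<open>1\<close>, the normalized primitive of a bump on \<open>(0, 1)\<close>, and
  \<open>G\<close> is a primitive of \<open>H\<close>. Since \<open>G\<close> is affine with slope one to the right of \<open>1\<close>, differences of
  rescaled copies of \<open>G\<close> are eventually constant, and test functions can be assembled from them.
\<close>

lemma smooth_ramp:
  obtains G H :: "real \<Rightarrow> real" and \<kappa> :: real
  where "smooth G" and "\<And>x. (G has_real_derivative H x) (at x)"
    and "\<And>x. x \<le> 0 \<Longrightarrow> G x = 0" and "\<And>x. x \<ge> 1 \<Longrightarrow> G x = x - \<kappa>"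
    and "\<And>x. x \<le> 0 \<Longrightarrow> H x = 0" and "\<And>x. x \<ge> 1 \<Longrightarrow> H x = 1" and "\<And>x. 0 \<le> H x \<and> H x \<le> 1"
proof -
  \<comment> \<open>The bump \<open>exp (- (1 / x)) * exp (- (1 / (1 - x)))\<close> on \<open>(0, 1)\<close>, in a shape that matches the closure lemmas.\<close>
  define b where "b x = flat 1 x * (1 * flat 1 ((-1) * x + 1))" for x
  have "smooth b" unfolding b_def by (intro smooth_mult smooth_affine smooth_flat)
  obtain F where F: "\<And>x. (F has_real_derivative b x) (at x)"
    using continuous_antiderivative[OF smooth_continuous_on[OF \<open>smooth b\<close>]] by blast
  have b0: "b x = 0" if "x \<le> 0 \<or> x \<ge> 1" for x using that by (auto simp: b_def flat_def)
  have b_pos: "b x \<ge> 0" for x by (simp add: b_def flat_def)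
  obtain z where z: "z > 0" "z < 1" "F 1 - F 0 = (1 - 0) * b z" using MVT2[of 0 1 F b] F by auto
  have "b z > 0" using z(1,2) by (simp add: b_def flat_def)
  then have pos: "F 1 - F 0 > 0" unfolding z(3) by simp
  define H where "H x = (F x - F 0) / (F 1 - F 0)" for x
  have H': "(H has_real_derivative b x / (F 1 - F 0)) (at x)" for x
    unfolding H_def using pos by (auto intro!: derivative_eq_intros F)
  have "smooth (\<lambda>x. b x / (F 1 - F 0))"
    using smooth_mult[OF smooth_const \<open>smooth b\<close>, of "1 / (F 1 - F 0)"] by simp
  then have "smooth H" by (rule smooth_if_smooth_derivative[OF H'])
  have Hl: "H x = 0" if "x \<le> 0" for x
    using constant_of_zero_derivative[OF F, of x 0] b0 that by (auto simp: H_def)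
  have Hr: "H x = 1" if "x \<ge> 1" for x
    using constant_of_zero_derivative[OF F, of 1 x] b0 that pos by (auto simp: H_def)
  have "mono H"
    by (rule monoI) (rule DERIV_nonneg_imp_nondecreasing, use H' b_pos pos in \<open>auto intro!: exI\<close>)
  have bounds: "0 \<le> H x \<and> H x \<le> 1" for x
    using monoD[OF \<open>mono H\<close>, of "min x 0" x] monoD[OF \<open>mono H\<close>, of x "max x 1"] Hl[of "min x 0"] Hr[of "max x 1"]
    by auto
  obtain G0 where G0: "\<And>x. (G0 has_real_derivative H x) (at x)"
    using continuous_antiderivative[OF smooth_continuous_on[OF \<open>smooth H\<close>]] by blast
  define G where "G x = G0 x - G0 0" for x
  have G': "(G has_real_derivative H x) (at x)" for x
    unfolding G_def by (auto intro!: derivative_eq_intros G0)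
  have Gl: "G x = 0" if "x \<le> 0" for x
    using constant_of_zero_derivative[OF G', of x 0] Hl that by (auto simp: G_def)
  have "((\<lambda>x. G x - x) has_real_derivative H x - 1) (at x)" for x
    by (auto intro!: derivative_eq_intros G')
  then have Gr: "G x = x - (1 - G 1)" if "x \<ge> 1" for x
    using constant_of_zero_derivative[of "\<lambda>x. G x - x" "\<lambda>x. H x - 1" 1 x] Hr that by force
  show thesis
    using that[OF smooth_if_smooth_derivative[OF G' \<open>smooth H\<close>] G' Gl Gr Hl Hr bounds] by blast
qed

lemma test_functionI:
  assumes "smooth \<phi>" and "\<And>x. x \<notin> {a..b} \<Longrightarrow> \<phi> x = 0" and "{a..b} \<subseteq> S"
  shows "\<phi> \<in> test_functions S"
proof -
  have "closure {x. \<phi> x \<noteq> 0} \<subseteq> {a..b}"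
    using assms(2) by (intro closure_minimal subsetI closed_atLeastAtMost) blast
  moreover then have "compact (closure {x. \<phi> x \<noteq> 0})"
    using compact_Icc compact_closure bounded_subset bounded_closed_interval closure_subset by (metis order_trans)
  ultimately show ?thesis
    using assms by (auto simp: test_functions_def smooth_def)
qed

lemma test_function_smooth: "\<phi> \<in> test_functions S \<Longrightarrow> smooth \<phi>"
  by (simp add: test_functions_def smooth_def)

lemma test_function_zero: "\<phi> \<in> test_functions S \<Longrightarrow> x \<notin> S \<Longrightarrow> \<phi> x = 0"
  using closure_subset[of "{x. \<phi> x \<noteq> 0}"] by (auto simp: test_functions_def)


section \<open>The lemma of du Bois-Reymond\<close>

lemma scaled_step_tendsto:
  fixes H :: "real \<Rightarrow> real"
  assumes "\<And>x. x \<le> 0 \<Longrightarrow> H x = 0" and "\<And>x. x \<ge> 1 \<Longrightarrow> H x = 1"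
  shows "(\<lambda>n. H (real (n + N) * (x - a))) \<longlonglongrightarrow> indicator {a<..} x"
proof (cases "x \<le> a")
  case True
  then show ?thesis using assms(1) by (simp add: mult_nonneg_nonpos)
next
  case False
  then obtain n0 :: nat where n0: "1 / (x - a) < real n0" using reals_Archimedean2 by blast
  have "H (real (n + N) * (x - a)) = 1" if "n \<ge> n0" for n
  proof (rule assms(2))
    have "1 < real n0 * (x - a)" using n0 False by (simp add: field_simps)
    also have "\<dots> \<le> real (n + N) * (x - a)" using False that by (intro mult_right_mono) auto
    finally show "1 \<le> real (n + N) * (x - a)" by simp
  qed
  then show ?thesis using False
    by (intro tendsto_eventually) (auto simp: eventually_sequentially)
qed

text \<open>
  A function can only be the derivative of a test function if its integral vanishes. The difference
  of two normalized indicators is therefore the simplest limit of such derivatives, and testing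
  with it compares the averages over two intervals.
\<close>

lemma test_functions_with_derivative_near_indicators:
  assumes "l < a" "a < b" "b < r" "l < c" "c < d" "d < r"
  obtains \<phi> :: "nat \<Rightarrow> real \<Rightarrow> real"
  where "\<And>n. \<phi> n \<in> test_functions {l<..<r}"
    and "\<And>n x. \<bar>deriv (\<phi> n) x\<bar> \<le> 1 / (b - a) + 1 / (d - c)"
    and "\<And>x. (\<lambda>n. deriv (\<phi> n) x) \<longlonglongrightarrow> indicator {a<..b} x / (b - a) - indicator {c<..d} x / (d - c)"
proof -
  obtain G H \<kappa> where "smooth G" and G': "\<And>x. (G has_real_derivative H x) (at x)"
    and Gl: "\<And>x. x \<le> 0 \<Longrightarrow> G x = 0" and Gr: "\<And>x. x \<ge> 1 \<Longrightarrow> G x = x - \<kappa>"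
    and Hl: "\<And>x. x \<le> 0 \<Longrightarrow> H x = 0" and Hr: "\<And>x. x \<ge> 1 \<Longrightarrow> H x = 1"
    and H: "\<And>x. 0 \<le> H x \<and> H x \<le> 1"
    by (rule smooth_ramp) blast
  define m where "m = max b d"
  have "m < r" using assms by (simp add: m_def)
  \<comment> \<open>The transition layers have width \<open>1 / k n\<close>; the offset \<open>N\<close> keeps the layer to the right of \<open>max b d\<close> inside \<open>(l, r)\<close>.\<close>
  obtain N :: nat where N: "1 / (r - m) < real N" using reals_Archimedean2 by blast
  have "0 < 1 / (r - m)" using \<open>m < r\<close> by simp
  then have "N > 0" using N by linarith
  define k where "k n = real (n + N)" for n
  have k: "k n > 0" "1 / k n \<le> 1 / real N" for n
    using \<open>N > 0\<close> by (auto simp: k_def intro!: divide_left_mono)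
  \<comment> \<open>A smooth ramp that rises from \<open>0\<close> to \<open>1\<close> on \<open>[a, b + 1 / k n]\<close>. The two ramps of \<open>\<phi>\<close> cancel far to the right.\<close>
  define \<psi> where "\<psi> a b n x = 1 / (k n * (b - a)) * G (k n * x + - k n * a) + - 1 / (k n * (b - a)) * G (k n * x + - k n * b)"
    for a b n x
  define \<phi> where "\<phi> n x = \<psi> a b n x - \<psi> c d n x" for n x
  have \<psi>': "(\<psi> a b n has_real_derivative (H (k n * (x - a)) - H (k n * (x - b))) / (b - a)) (at x)"
    if "a < b" for a b n x
  proof -
    have arg: "k n * x + - k n * c = k n * (x - c)" for c by (simp add: algebra_simps)
    have der: "(\<psi> a b n has_real_derivative 1 / (k n * (b - a)) * (k n * H (k n * x + - k n * a))
        + - 1 / (k n * (b - a)) * (k n * H (k n * x + - k n * b))) (at x)"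
      unfolding \<psi>_def using that by (auto intro!: derivative_eq_intros DERIV_chain'[OF _ G'])
    have "1 / (\<kappa> * e) * (\<kappa> * u) + - 1 / (\<kappa> * e) * (\<kappa> * v) = (u - v) / e" if "\<kappa> > 0" for \<kappa> e u v :: real
      using that by (simp add: diff_divide_distrib)
    from this[OF k(1)] have "1 / (k n * (b - a)) * (k n * H (k n * x + - k n * a))
        + - 1 / (k n * (b - a)) * (k n * H (k n * x + - k n * b))
        = (H (k n * (x - a)) - H (k n * (x - b))) / (b - a)"
      unfolding arg .
    with der show ?thesis by (simp only:)
  qed
  have d\<phi>: "deriv (\<phi> n) x = (H (k n * (x - a)) - H (k n * (x - b))) / (b - a)
      - (H (k n * (x - c)) - H (k n * (x - d))) / (d - c)" for n x
    unfolding \<phi>_def using assms by (intro DERIV_imp_deriv derivative_intros \<psi>')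
  have test: "\<phi> n \<in> test_functions {l<..<r}" for n
  proof (rule test_functionI)
    show "smooth (\<phi> n)"
      unfolding \<phi>_def \<psi>_def by (intro smooth_add smooth_diff smooth_affine \<open>smooth G\<close>)
    have "k n > 0" by (rule k)
    have left: "\<psi> a b n x = 0" if "a < b" "x \<le> a" for a b x
      using that \<open>k n > 0\<close> Gl by (simp add: \<psi>_def)
    have right: "\<psi> a b n x = 1" if "a < b" "x \<ge> b + 1 / k n" for a b x
    proof -
      have *: "k n * x + - k n * b \<ge> 1" using that \<open>k n > 0\<close> by (simp add: field_simps)
      moreover have "k n * a \<le> k n * b" using that \<open>k n > 0\<close> by simp
      ultimately have "G (k n * x + - k n * a) - G (k n * x + - k n * b) = k n * (b - a)"
        using Gr[of "k n * x + - k n * a"] Gr[OF *] by (simp add: algebra_simps)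
      moreover have "1 / e * u + - 1 / e * v = 1" if "u - v = e" "e > 0" for e u v :: real
        using that by (simp add: diff_divide_distrib[symmetric])
      moreover have "k n * (b - a) > 0" using that \<open>k n > 0\<close> by simp
      ultimately show ?thesis unfolding \<psi>_def by blast
    qed
    show "\<phi> n x = 0" if "x \<notin> {min a c..m + 1 / k n}" for x
      using that assms left[of a b x] left[of c d x] right[of a b x] right[of c d x]
      by (auto simp: \<phi>_def m_def)
    have "1 / real N < r - m" using N \<open>m < r\<close> \<open>N > 0\<close> by (simp add: field_simps)
    then show "{min a c..m + 1 / k n} \<subseteq> {l<..<r}" using k(2)[of n] assms by auto
  qed
  have bound: "\<bar>deriv (\<phi> n) x\<bar> \<le> 1 / (b - a) + 1 / (d - c)" for n x
  proof -
    have "\<bar>(H s - H t) / e\<bar> \<le> 1 / e" if "e > 0" for s t e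
    proof -
      have "\<bar>H s - H t\<bar> \<le> 1" using H[of s] H[of t] by linarith
      then show ?thesis using that by (simp add: divide_right_mono)
    qed
    from this[of "b - a"] this[of "d - c"] assms
    have "\<bar>(H (k n * (x - a)) - H (k n * (x - b))) / (b - a)\<bar> \<le> 1 / (b - a)"
      "\<bar>(H (k n * (x - c)) - H (k n * (x - d))) / (d - c)\<bar> \<le> 1 / (d - c)" by simp_all
    then show ?thesis unfolding d\<phi> by linarith
  qed
  have lim: "(\<lambda>n. deriv (\<phi> n) x) \<longlonglongrightarrow> indicator {a<..b} x / (b - a) - indicator {c<..d} x / (d - c)" for x
  proof -
    have ind: "indicator {a<..b} x = indicator {a<..} x - (indicator {b<..} x :: real)" if "a < b" for a b
      using that by (auto simp: indicator_def)
    show ?thesis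
      unfolding d\<phi> k_def ind[OF \<open>a < b\<close>] ind[OF \<open>c < d\<close>]
      using assms by (intro tendsto_intros scaled_step_tendsto Hl Hr) auto
  qed
  show thesis using that[OF test bound lim] .
qed

text \<open>
  The sets over which \<open>f\<close> integrates to zero form a Dynkin system that contains the intervals, hence
  all Borel sets; a Lebesgue set differs from a Borel set by a null set.
\<close>

lemma AE_zero_if_integrals_over_intervals_zero:
  fixes f :: "real \<Rightarrow> real"
  assumes f: "integrable lebesgue f" and zero: "\<And>a b. (LINT x:{a<..<b}|lebesgue. f x) = 0"
  shows "AE x in lebesgue. f x = 0"
proof -
  have fS: "set_integrable lebesgue A f" if "A \<in> sets lebesgue" for A
    using f that unfolding set_integrable_def by (rule integrable_mult_indicator[rotated])
  have "(\<lambda>n. LINT x:{- real n<..<real n}|lebesgue. f x) \<longlonglongrightarrow> (LINT x|lebesgue. f x)"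
    unfolding set_lebesgue_integral_def
  proof (rule integral_dominated_convergence[where w = "\<lambda>x. \<bar>f x\<bar>"])
    have "(\<lambda>n. indicator {- real n<..<real n} x *\<^sub>R f x) \<longlonglongrightarrow> f x" for x
    proof (rule tendsto_eventually)
      obtain n0 :: nat where "\<bar>x\<bar> < real n0" using reals_Archimedean2 by blast
      then show "\<forall>\<^sub>F n in sequentially. indicator {- real n<..<real n} x *\<^sub>R f x = f x"
        by (intro eventually_sequentiallyI[of n0]) (auto simp: indicator_def)
    qed
    then show "AE x in lebesgue. (\<lambda>n. indicator {- real n<..<real n} x *\<^sub>R f x) \<longlonglongrightarrow> f x" by simp
  qed (use f in \<open>auto intro!: borel_measurable_times borel_measurable_indicator split: split_indicator\<close>)
  then have total: "(LINT x|lebesgue. f x) = 0"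
    by (simp add: zero LIMSEQ_const_iff)
  have borel: "(LINT x:A|lebesgue. f x) = 0" if "A \<in> sets borel" for A
  proof -
    let ?G = "range (\<lambda>(a, b). {a<..<b :: real})"
    have "borel = sigma UNIV ?G"
      unfolding borel_eq_box by (simp add: case_prod_unfold)
    then have sb: "sigma_sets UNIV ?G = sets borel"
      by (metis Pow_UNIV subset_UNIV sets_measure_of)
    then have gen: "B \<in> sets lebesgue" if "B \<in> sigma_sets UNIV ?G" for B
      using that sets_completionI_sets[of B lborel] by simp
    have "Int_stable ?G"
    proof (rule Int_stableI)
      fix A B assume "A \<in> ?G" "B \<in> ?G"
      then obtain a b c d where "A = {a<..<b}" "B = {c<..<d}" by auto
      then have "A \<inter> B = {max a c<..<min b d}" by auto
      then show "A \<inter> B \<in> ?G" by (intro image_eqI[where x = "(max a c, min b d)"]) auto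
    qed
    moreover have "?G \<subseteq> Pow UNIV" by simp
    moreover have "A \<in> sigma_sets UNIV ?G" using that sb by simp
    ultimately show ?thesis
    proof (induction rule: sigma_sets_induct_disjoint)
      case (basic A)
      then show ?case using zero by auto
    next
      case empty
      show ?case by (simp add: set_lebesgue_integral_def)
    next
      case (compl A)
      then have "A \<in> sets lebesgue" by (simp add: gen)
      then have "(LINT x:UNIV - A|lebesgue. f x) = (LINT x:UNIV|lebesgue. f x) - (LINT x:A|lebesgue. f x)"
        using set_integral_Un[of A "UNIV - A" lebesgue f] fS[of A] fS[of "UNIV - A"] by (simp add: sets.Diff)
      moreover have "(LINT x:UNIV|lebesgue. f x) = 0"
        using total by (simp add: set_lebesgue_integral_def)
      ultimately show ?case by (simp only: compl(2) diff_self)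
    next
      case (union A)
      then have "A i \<in> sets lebesgue" for i by (intro gen) blast
      then have "(LINT x:(\<Union>i. A i)|lebesgue. f x) = (\<Sum>i. (LINT x:(A i)|lebesgue. f x))"
        using union(1) by (intro lebesgue_integral_countable_add fS) (auto simp: disjoint_family_on_def)
      then show ?case by (simp add: union(3))
    qed
  qed
  show ?thesis
  proof (rule density_unique_real[OF f])
    show "integrable lebesgue (\<lambda>x. 0 :: real)" by simp
    fix A assume "A \<in> sets (lebesgue :: real measure)"
    then obtain S N N' where A: "A = S \<union> N" "N \<subseteq> N'" "N' \<in> null_sets lborel" "S \<in> sets lborel"
      by (rule sets_completionE)
    have "AE x in lebesgue. x \<notin> N'"
      using A(3) by (intro AE_completion AE_not_in)
    then have "AE x in lebesgue. indicator A x *\<^sub>R f x = indicator S x *\<^sub>R f x"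
      by eventually_elim (use A(1,2) in \<open>auto simp: indicator_def\<close>)
    moreover have "S \<in> sets lebesgue" using A(4) by simp
    ultimately have "(LINT x:A|lebesgue. f x) = (LINT x:S|lebesgue. f x)"
      using fS \<open>A \<in> sets lebesgue\<close> unfolding set_lebesgue_integral_def set_integrable_def
      by (intro integral_cong_AE borel_measurable_integrable)
    then show "(LINT x:A|lebesgue. f x) = (LINT x:A|lebesgue. 0)"
      using borel A(4) by (simp add: set_lebesgue_integral_def)
  qed
qed

text \<open>
  A function with vanishing weak derivative has the same average over all intervals, so it is
  constant almost everywhere.
\<close>

lemma du_Bois_Reymond:
  fixes q :: "real \<Rightarrow> real"
  assumes q: "integrable (lebesgue_on {l<..<r}) q" and "l < r"
    and weak: "\<And>\<phi>. \<phi> \<in> test_functions {l<..<r} \<Longrightarrow> (LINT x|lebesgue_on {l<..<r}. q x * deriv \<phi> x) = 0"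
  obtains K where "AE x in lebesgue_on {l<..<r}. q x = K"
proof -
  let ?M = "lebesgue_on {l<..<r}"
  interpret finite_measure ?M by (rule finite_measure_lebesgue_on) simp
  define I where "I a b = (LINT x|?M. q x * indicator {a<..b} x)" for a b
  have qi: "integrable ?M (\<lambda>x. q x * indicator {a<..b} x)" for a b
    using integrable_mult_indicator[OF _ q, of "{a<..b} \<inter> {l<..<r}"]
    by (rule Bochner_Integration.integrable_cong[THEN iffD1, rotated -1])
       (auto simp: sets_restrict_space_iff split: split_indicator)
  have average: "I a b / (b - a) = I c d / (d - c)"
    if abcd: "l < a" "a < b" "b < r" "l < c" "c < d" "d < r" for a b c d
  proof -
    obtain \<phi> where \<phi>: "\<And>n. \<phi> n \<in> test_functions {l<..<r}"
      "\<And>n x. \<bar>deriv (\<phi> n) x\<bar> \<le> 1 / (b - a) + 1 / (d - c)"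
      "\<And>x. (\<lambda>n. deriv (\<phi> n) x) \<longlonglongrightarrow> indicator {a<..b} x / (b - a) - indicator {c<..d} x / (d - c)"
      using test_functions_with_derivative_near_indicators[OF abcd] by blast
    have m: "deriv (\<phi> n) \<in> borel_measurable ?M" for n
      using smooth_continuous_on[OF smooth_deriv[OF test_function_smooth[OF \<phi>(1)]]]
      by (intro continuous_imp_measurable_on_sets_lebesgue) auto
    have mi: "(\<lambda>x. indicator {a<..b} x :: real) \<in> borel_measurable ?M" for a b
      by (intro measurable_restrict_space1 borel_measurable_indicator) simp
    have "(\<lambda>n. LINT x|?M. q x * deriv (\<phi> n) x)
      \<longlonglongrightarrow> (LINT x|?M. q x * (indicator {a<..b} x / (b - a) - indicator {c<..d} x / (d - c)))"
    proof (rule integral_dominated_convergence[where w = "\<lambda>x. \<bar>q x\<bar> * (1 / (b - a) + 1 / (d - c))"])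
      show "AE x in ?M. (\<lambda>n. q x * deriv (\<phi> n) x)
          \<longlonglongrightarrow> q x * (indicator {a<..b} x / (b - a) - indicator {c<..d} x / (d - c))"
        by (intro AE_I2 tendsto_mult tendsto_const \<phi>(3))
      show "AE x in ?M. norm (q x * deriv (\<phi> n) x) \<le> \<bar>q x\<bar> * (1 / (b - a) + 1 / (d - c))" for n
        using \<phi>(2) by (intro AE_I2) (auto simp: abs_mult intro!: mult_left_mono)
    qed (use q m mi in auto)
    then have "(LINT x|?M. q x * (indicator {a<..b} x / (b - a) - indicator {c<..d} x / (d - c))) = 0"
      using weak[OF \<phi>(1)] by (simp add: LIMSEQ_const_iff)
    moreover have "(LINT x|?M. q x * (indicator {a<..b} x / (b - a) - indicator {c<..d} x / (d - c)))
        = (LINT x|?M. q x * indicator {a<..b} x / (b - a) - q x * indicator {c<..d} x / (d - c))"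
      by (simp add: right_diff_distrib)
    ultimately show ?thesis
      using qi by (simp add: I_def)
  qed
  have ii: "integrable ?M (\<lambda>x. K * indicator {a<..b} x)" for a b K :: real
  proof -
    have "(\<lambda>x. indicator {a<..b} x :: real) \<in> borel_measurable ?M"
      by (intro measurable_restrict_space1 borel_measurable_indicator) simp
    then show ?thesis
      by (intro Bochner_Integration.integrable_bound[OF integrable_const[of K]]) (auto split: split_indicator)
  qed
  obtain c d where cd: "l < c" "c < d" "d < r" using dense[OF \<open>l < r\<close>] dense by blast
  define K where "K = I c d / (d - c)"
  have I: "I a b = K * (b - a)" if "l < a" "a < b" "b < r" for a b
    using average[OF that cd] that by (simp add: K_def field_simps)
  have qK: "integrable ?M (\<lambda>x. q x - K)"
    using q integrable_const by (rule Bochner_Integration.integrable_diff)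
  define f where "f x = indicator {l<..<r} x *\<^sub>R (q x - K)" for x
  have f: "integrable lebesgue f"
    using qK unfolding f_def by (subst (asm) integrable_restrict_space) auto
  have closed_interval: "(LINT x:{a<..b}|lebesgue. f x) = 0" if "l < a" "a < b" "b < r" for a b
  proof -
    have "(LINT x:{a<..b}|lebesgue. f x)
        = (LINT x|lebesgue. indicator {l<..<r} x *\<^sub>R (q x * indicator {a<..b} x - K * indicator {a<..b} x))"
      unfolding set_lebesgue_integral_def f_def
      by (intro Bochner_Integration.integral_cong refl) (simp split: split_indicator)
    also have "\<dots> = (LINT x|?M. q x * indicator {a<..b} x - K * indicator {a<..b} x)"
      by (rule integral_restrict_space[symmetric]) simp
    also have "\<dots> = I a b - K * (LINT x|?M. indicator {a<..b} x)"
      unfolding I_def using qi ii by (subst Bochner_Integration.integral_diff) auto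
    also have "(LINT x|?M. indicator {a<..b} x) = b - a"
      using that by (simp add: measure_restrict_space Int_absorb2 subset_eq)
    finally show ?thesis using I[OF that] by simp
  qed
  \<comment> \<open>Test functions only reach intervals with closure inside \<open>(l, r)\<close>; the others are exhausted by such intervals.\<close>
  have "(LINT x:{a<..<b}|lebesgue. f x) = 0" for a b
  proof (cases "max a l < min b r")
    case True
    define a' b' where "a' = max a l" and "b' = min b r"
    define \<delta> where "\<delta> n = (b' - a') / 3 * inverse (real (Suc n))" for n
    have "a' < b'" using True by (simp add: a'_def b'_def)
    have \<delta>: "\<delta> n > 0" "a' + \<delta> n < b' - \<delta> n" for n
    proof -
      show "\<delta> n > 0" using \<open>a' < b'\<close> by (simp add: \<delta>_def)
      have "\<delta> n \<le> (b' - a') / 3 * 1"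
        unfolding \<delta>_def using \<open>a' < b'\<close> by (intro mult_left_mono) (auto simp: field_simps)
      then have "\<delta> n \<le> (b' - a') / 3" by simp
      then show "a' + \<delta> n < b' - \<delta> n" using \<open>a' < b'\<close> by (simp add: field_simps)
    qed
    have \<delta>0: "\<delta> \<longlonglongrightarrow> 0"
      unfolding \<delta>_def by (intro tendsto_mult_right_zero LIMSEQ_inverse_real_of_nat)
    have "(\<lambda>n. LINT x:{a' + \<delta> n<..b' - \<delta> n}|lebesgue. f x) \<longlonglongrightarrow> (LINT x:{a<..<b}|lebesgue. f x)"
      unfolding set_lebesgue_integral_def
    proof (rule integral_dominated_convergence[where w = "\<lambda>x. \<bar>f x\<bar>"])
      have "(\<lambda>n. indicator {a' + \<delta> n<..b' - \<delta> n} x *\<^sub>R f x) \<longlonglongrightarrow> indicator {a<..<b} x *\<^sub>R f x" for x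
      proof (cases "x \<in> {a'<..<b'}")
        case True
        then have "eventually (\<lambda>n. \<delta> n < min (x - a') (b' - x)) sequentially"
          using \<delta>0 by (intro order_tendstoD) auto
        then have "eventually (\<lambda>n. indicator {a' + \<delta> n<..b' - \<delta> n} x *\<^sub>R f x = indicator {a<..<b} x *\<^sub>R f x) sequentially"
          by eventually_elim (use True in \<open>auto simp: indicator_def a'_def b'_def\<close>)
        then show ?thesis by (rule tendsto_eventually)
      next
        case False
        then have "indicator {a<..<b} x *\<^sub>R f x = 0" by (auto simp: f_def indicator_def a'_def b'_def)
        moreover have "indicator {a' + \<delta> n<..b' - \<delta> n} x *\<^sub>R f x = 0" for n
          using False \<delta>(1)[of n] by (auto simp: indicator_def)
        ultimately show ?thesis by (simp only: tendsto_const)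
      qed
      then show "AE x in lebesgue. (\<lambda>n. indicator {a' + \<delta> n<..b' - \<delta> n} x *\<^sub>R f x) \<longlonglongrightarrow> indicator {a<..<b} x *\<^sub>R f x"
        by simp
    qed (use f in \<open>auto intro!: borel_measurable_times borel_measurable_indicator split: split_indicator\<close>)
    moreover have "(LINT x:{a' + \<delta> n<..b' - \<delta> n}|lebesgue. f x) = 0" for n
    proof (rule closed_interval)
      have "l \<le> a'" "b' \<le> r" by (simp_all add: a'_def b'_def)
      then show "l < a' + \<delta> n" "b' - \<delta> n < r" using \<delta>(1)[of n] by linarith+
    qed (rule \<delta>(2))
    ultimately show ?thesis by (simp add: LIMSEQ_const_iff)
  next
    case False
    then have "indicator {a<..<b} x *\<^sub>R f x = 0" for x by (auto simp: f_def indicator_def)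
    then show ?thesis by (simp only: set_lebesgue_integral_def Bochner_Integration.integral_zero)
  qed
  then have "AE x in lebesgue. f x = 0"
    by (rule AE_zero_if_integrals_over_intervals_zero[OF f])
  then have "AE x in lebesgue. x \<in> {l<..<r} \<longrightarrow> q x = K"
    by eventually_elim (auto simp: f_def split: split_indicator_asm)
  then have "AE x in ?M. q x = K"
    by (subst AE_restrict_space_iff) simp_all
  then show thesis by (rule that)
qed


section \<open>Primitives on the interval from -1 to 1\<close>

abbreviation leb_interval :: "real measure" where
  "leb_interval \<equiv> lebesgue_on {-1<..<1}"

interpretation leb_interval: finite_measure leb_interval
  by (rule finite_measure_lebesgue_on) simp

interpretation leb_square: pair_sigma_finite leb_interval leb_interval ..

lemma measurable_id_leb_interval [measurable]: "(\<lambda>x. x) \<in> borel_measurable leb_interval"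
  using id_borel_measurable_lebesgue_on by (simp add: id_def)

lemma continuous_borel_measurable_leb_interval:
  "continuous_on UNIV f \<Longrightarrow> f \<in> borel_measurable leb_interval" for f :: "real \<Rightarrow> real"
  by (intro continuous_imp_measurable_on_sets_lebesgue) (auto intro: continuous_on_subset)

lemma continuous_bounded_leb_interval:
  fixes f :: "real \<Rightarrow> real"
  assumes "continuous_on UNIV f"
  obtains B where "\<And>x. x \<in> {-1<..<1} \<Longrightarrow> \<bar>f x\<bar> \<le> B"
proof -
  have "compact (f ` {-1..1})"
    using assms by (intro compact_continuous_image) (auto intro: continuous_on_subset)
  then have "bounded (f ` {-1..1})" by (rule compact_imp_bounded)
  then obtain B where "\<forall>y\<in>f ` {-1..1}. norm y \<le> B" by (auto simp: bounded_iff)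
  then show thesis using that[of B] by simp
qed

lemma integrable_mult_continuous:
  assumes u: "integrable leb_interval u" and f: "continuous_on UNIV f"
  shows "integrable leb_interval (\<lambda>x. u x * f x :: real)"
proof -
  obtain B where B: "\<And>x. x \<in> {-1<..<1} \<Longrightarrow> \<bar>f x\<bar> \<le> B"
    using continuous_bounded_leb_interval[OF f] by blast
  show ?thesis
  proof (rule Bochner_Integration.integrable_bound)
    show "integrable leb_interval (\<lambda>x. B * u x)" using u by simp
    show "(\<lambda>x. u x * f x) \<in> borel_measurable leb_interval"
      using u continuous_borel_measurable_leb_interval[OF f] by (intro borel_measurable_times) auto
    show "AE x in leb_interval. norm (u x * f x) \<le> norm (B * u x)"
    proof (rule AE_I2)
      fix x assume "x \<in> space leb_interval"
      then have "\<bar>f x\<bar> \<le> \<bar>B\<bar>" using B[of x] by auto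
      then show "norm (u x * f x) \<le> norm (B * u x)"
        by (simp add: abs_mult mult.commute mult_right_mono)
    qed
  qed
qed

lemma integrable_continuous_leb_interval:
  "continuous_on UNIV f \<Longrightarrow> integrable leb_interval f" for f :: "real \<Rightarrow> real"
  using integrable_mult_continuous[OF leb_interval.integrable_const[of 1]] by simp

lemma integral_derivative_between:
  assumes "-1 \<le> a" "a \<le> b" "b \<le> 1"
    and F: "\<And>x. (F has_real_derivative f x) (at x)" and f: "continuous_on UNIV f"
    and S: "{a<..<b} \<subseteq> S" "S \<subseteq> {a..b}"
  shows "integrable leb_interval (\<lambda>x. indicator S x * f x)"
    and "(LINT x|leb_interval. indicator S x * f x) = F b - F a"
proof -
  let ?g = "\<lambda>x. indicator {-1<..<1} x *\<^sub>R (indicator S x * f x)"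
  let ?h = "\<lambda>x. indicator {a..b} x *\<^sub>R f x"
  have h: "integrable lborel ?h"
    using borel_integrable_atLeastAtMost'[of a b f] f
    by (auto simp: set_integrable_def intro: continuous_on_subset)
  have "S = {a<..<b} \<union> (S \<inter> {a, b})" using S by force
  then have "S \<in> sets borel"
    by (metis finite.emptyI finite.insertI finite_Int finite_imp_closed borel_closed borel_open open_greaterThanLessThan sets.Un)
  moreover have mf: "f \<in> borel_measurable borel" using f by (rule borel_measurable_continuous_onI)
  ultimately have g: "?g \<in> borel_measurable borel" by (intro borel_measurable_scaleR borel_measurable_times borel_measurable_indicator) auto
  then have gl: "?g \<in> borel_measurable lebesgue" by (simp add: measurable_completion)
  have hl: "?h \<in> borel_measurable lebesgue"
    using borel_measurable_integrable[OF h] by (rule measurable_completion)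
  have "AE x in lebesgue. x \<notin> {-1, 1, a, b}"
    by (intro AE_completion AE_not_in finite_imp_null_set_lborel) simp
  then have AE: "AE x in lebesgue. ?g x = ?h x"
  proof eventually_elim
    case (elim x)
    then have "x \<in> S \<longleftrightarrow> x \<in> {a<..<b}" "x \<in> {a..b} \<longleftrightarrow> x \<in> {a<..<b}" using S by force+
    moreover have "x \<in> {a<..<b} \<Longrightarrow> x \<in> {-1<..<1}" using assms(1,3) by auto
    ultimately show ?case by (auto split: split_indicator)
  qed
  have hi: "integrable lebesgue ?h" using h by (simp add: integrable_completion)
  then have "integrable lebesgue ?g" using integrable_cong_AE[OF gl hl AE] by blast
  then show "integrable leb_interval (\<lambda>x. indicator S x * f x)"
    by (subst integrable_restrict_space) auto
  have "(LINT x|leb_interval. indicator S x * f x) = (LINT x|lebesgue. ?g x)"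
    by (rule integral_restrict_space) simp
  also have "\<dots> = (LINT x|lebesgue. ?h x)" by (rule integral_cong_AE[OF gl hl AE])
  also have "\<dots> = (LINT x|lborel. ?h x)"
    using borel_measurable_integrable[OF h] by (rule integral_completion)
  also have "\<dots> = F b - F a"
    using assms F f
    by (intro integral_FTC_atLeastAtMost)
       (auto simp: has_real_derivative_iff_has_vector_derivative[symmetric]
             intro: has_field_derivative_at_within continuous_on_subset)
  finally show "(LINT x|leb_interval. indicator S x * f x) = F b - F a" .
qed

text \<open>
  The kernel of the primitive that vanishes at the midpoint: integrating \<open>f\<close> against
  \<open>\<lambda>t. oriented t s\<close> gives the integral of \<open>f\<close> from \<open>0\<close> to \<open>s\<close>, with the sign that this has for
  negative \<open>s\<close>.
\<close>

definition oriented :: "real \<Rightarrow> real \<Rightarrow> real" where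
  "oriented t s = (if 0 \<le> t \<and> t < s then 1 else if s < t \<and> t < 0 then -1 else 0)"

text \<open>
  In the other variable the kernel integrates from \<open>t\<close> to the endpoint on its own side. This is
  why a derivative \<open>F'\<close> with \<open>F 1 = F (-1) = 0\<close> gives \<open>- F t\<close>.
\<close>

lemma oriented_integral_snd:
  assumes t: "t \<in> {-1<..<1}" and F: "\<And>x. (F has_real_derivative f x) (at x)" and f: "continuous_on UNIV f"
  shows "integrable leb_interval (\<lambda>s. oriented t s * f s)"
    and "(LINT s|leb_interval. oriented t s * f s) = (if 0 \<le> t then F 1 - F t else F (-1) - F t)"
proof -
  have "integrable leb_interval (\<lambda>s. oriented t s * f s) \<and>
    (LINT s|leb_interval. oriented t s * f s) = (if 0 \<le> t then F 1 - F t else F (-1) - F t)"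
  proof (cases "0 \<le> t")
    case True
    have eq: "oriented t s * f s = indicator {t<..1} s * f s" if "s \<in> space leb_interval" for s
      using that True by (auto simp: oriented_def)
    have S: "{t<..<1} \<subseteq> {t<..1}" "{t<..1} \<subseteq> {t..1}" by auto
    show ?thesis
      using integral_derivative_between[OF _ _ _ F f S] t True
        Bochner_Integration.integrable_cong[OF refl eq, of leb_interval]
        Bochner_Integration.integral_cong[OF refl eq, of leb_interval]
      by simp
  next
    case False
    have eq: "oriented t s * f s = - (indicator {-1..<t} s * f s)" if "s \<in> space leb_interval" for s
      using that False by (auto simp: oriented_def)
    have S: "{-1<..<t} \<subseteq> {-1..<t}" "{-1..<t} \<subseteq> {-1..t}" by auto
    show ?thesis
      using integral_derivative_between[OF _ _ _ F f S] t False
        Bochner_Integration.integrable_cong[OF refl eq, of leb_interval]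
        Bochner_Integration.integral_cong[OF refl eq, of leb_interval]
      by simp
  qed
  then show "integrable leb_interval (\<lambda>s. oriented t s * f s)"
    and "(LINT s|leb_interval. oriented t s * f s) = (if 0 \<le> t then F 1 - F t else F (-1) - F t)"
    by blast+
qed

lemma oriented_integral_fst:
  assumes s: "s \<in> {-1<..<1}" and F: "\<And>x. (F has_real_derivative f x) (at x)" and f: "continuous_on UNIV f"
  shows "integrable leb_interval (\<lambda>t. oriented t s * f t)"
    and "(LINT t|leb_interval. oriented t s * f t) = F s - F 0"
proof -
  have "integrable leb_interval (\<lambda>t. oriented t s * f t) \<and>
    (LINT t|leb_interval. oriented t s * f t) = F s - F 0"
  proof (cases "0 \<le> s")
    case True
    have eq: "oriented t s * f t = indicator {0..<s} t * f t" for t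
      using True by (auto simp: oriented_def)
    have S: "{0<..<s} \<subseteq> {0..<s}" "{0..<s} \<subseteq> {0..s}" by auto
    show ?thesis
      using integral_derivative_between[OF _ _ _ F f S] s True
      by (auto simp: eq)
  next
    case False
    have eq: "oriented t s * f t = - (indicator {s<..<0} t * f t)" for t
      using False by (auto simp: oriented_def)
    have S: "{s<..<0} \<subseteq> {s<..<0}" "{s<..<0} \<subseteq> {s..0}" by auto
    show ?thesis
      using integral_derivative_between[OF _ _ _ F f S] s False
      by (auto simp: eq)
  qed
  then show "integrable leb_interval (\<lambda>t. oriented t s * f t)"
    and "(LINT t|leb_interval. oriented t s * f t) = F s - F 0"
    by blast+
qed

lemma borel_measurable_oriented [measurable]:
  "(\<lambda>(t, s). oriented t s) \<in> borel_measurable (leb_interval \<Otimes>\<^sub>M leb_interval)"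
  unfolding oriented_def case_prod_unfold by measurable

lemma integrable_oriented_product:
  assumes f: "integrable leb_interval f" and g: "integrable leb_interval g"
  shows "integrable (leb_interval \<Otimes>\<^sub>M leb_interval) (\<lambda>(t, s). oriented t s * f t * g s)"
proof -
  have [measurable]: "f \<in> borel_measurable leb_interval" "g \<in> borel_measurable leb_interval"
    using f g by auto
  have "integrable (leb_interval \<Otimes>\<^sub>M leb_interval) (\<lambda>p. f (fst p) * g (snd p))"
  proof (rule leb_square.Fubini_integrable)
    have "(LINT s|leb_interval. norm (f t * g s)) = \<bar>f t\<bar> * (LINT s|leb_interval. \<bar>g s\<bar>)" for t
      by (simp add: abs_mult)
    then show "integrable leb_interval (\<lambda>t. LINT s|leb_interval. norm (f (fst (t, s)) * g (snd (t, s))))"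
      using f by simp
  qed (use g in auto)
  then show ?thesis
  proof (rule Bochner_Integration.integrable_bound)
    show "(\<lambda>(t, s). oriented t s * f t * g s) \<in> borel_measurable (leb_interval \<Otimes>\<^sub>M leb_interval)"
      by (simp add: case_prod_unfold) measurable
  qed (auto simp: oriented_def)
qed

definition midpoint_primitive :: "(real \<Rightarrow> real) \<Rightarrow> real \<Rightarrow> real" where
  "midpoint_primitive f s = (LINT t|leb_interval. oriented t s * f t)"

text \<open>
  Fubini's theorem for \<open>oriented t s * f t * g s\<close>: the double integral is used for the energy
  estimate, the last form is integration by parts.
\<close>

lemma midpoint_primitive_mult:
  assumes f: "integrable leb_interval f" and g: "integrable leb_interval g"
  shows "integrable leb_interval (\<lambda>s. midpoint_primitive f s * g s)"
    and "(LINT s|leb_interval. midpoint_primitive f s * g s)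
      = (LINT p|(leb_interval \<Otimes>\<^sub>M leb_interval). oriented (fst p) (snd p) * f (fst p) * g (snd p))"
    and "(LINT s|leb_interval. midpoint_primitive f s * g s)
      = (LINT t|leb_interval. f t * (LINT s|leb_interval. oriented t s * g s))"
proof -
  note i = integrable_oriented_product[OF f g]
  have eq: "midpoint_primitive f s * g s = (LINT t|leb_interval. oriented t s * f t * g s)" for s
    by (simp add: midpoint_primitive_def)
  show "integrable leb_interval (\<lambda>s. midpoint_primitive f s * g s)"
    unfolding eq by (rule leb_square.integrable_snd[OF i])
  show "(LINT s|leb_interval. midpoint_primitive f s * g s)
      = (LINT p|(leb_interval \<Otimes>\<^sub>M leb_interval). oriented (fst p) (snd p) * f (fst p) * g (snd p))"
    unfolding eq leb_square.integral_snd[OF i] by (simp add: case_prod_unfold)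
  have "(LINT s|leb_interval. midpoint_primitive f s * g s)
      = (LINT t|leb_interval. LINT s|leb_interval. oriented t s * f t * g s)"
    unfolding eq by (rule leb_square.Fubini_integral[OF i])
  also have "\<dots> = (LINT t|leb_interval. f t * (LINT s|leb_interval. oriented t s * g s))"
    by (intro Bochner_Integration.integral_cong refl) (simp add: mult.commute mult.left_commute flip: integral_mult_right_zero)
  finally show "(LINT s|leb_interval. midpoint_primitive f s * g s)
      = (LINT t|leb_interval. f t * (LINT s|leb_interval. oriented t s * g s))" .
qed

lemma L2_on_integrable:
  assumes "u \<in> L2_on {-1<..<1}" shows "integrable leb_interval u"
proof (rule Bochner_Integration.integrable_bound)
  show "integrable leb_interval (\<lambda>x. 1 + (u x)\<^sup>2)"
    using assms by (auto simp: L2_on_def)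
  show "u \<in> borel_measurable leb_interval" using assms by (simp add: L2_on_def)
  have "\<bar>u x\<bar> \<le> 1 + (u x)\<^sup>2" for x
    using sum_squares_bound[of "\<bar>u x\<bar>" 1] by (simp add: power2_eq_square)
  then show "AE x in leb_interval. norm (u x) \<le> norm (1 + (u x)\<^sup>2)" by simp
qed

text \<open>
  The primitive of \<open>u'\<close> has the weak derivative \<open>u'\<close> as well, so its difference to \<open>u\<close> is
  annihilated by all derivatives of test functions.
\<close>

lemma weakly_differentiable_eq_midpoint_primitive:
  assumes "(u, u') \<in> W12_with_derivative {-1<..<1}"
  obtains K where "AE x in leb_interval. u x = midpoint_primitive u' x + K"
proof -
  have u: "integrable leb_interval u" and u': "integrable leb_interval u'"
    using assms L2_on_integrable by (auto simp: W12_with_derivative_def)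
  have U: "integrable leb_interval (midpoint_primitive u')"
    using midpoint_primitive_mult(1)[OF u' leb_interval.integrable_const[of 1]] by simp
  have "(LINT x|leb_interval. (u x - midpoint_primitive u' x) * deriv \<phi> x) = 0"
    if \<phi>: "\<phi> \<in> test_functions {-1<..<1}" for \<phi>
  proof -
    note smooth = test_function_smooth[OF \<phi>]
    note c = smooth_continuous_on[OF smooth_deriv[OF smooth]]
    have inner: "(LINT s|leb_interval. oriented t s * deriv \<phi> s) = - \<phi> t" if "t \<in> {-1<..<1}" for t
      using oriented_integral_snd(2)[OF that smooth_has_derivative[OF smooth] c]
        test_function_zero[OF \<phi>, of 1] test_function_zero[OF \<phi>, of "-1"] by (simp split: if_splits)
    have "(LINT x|leb_interval. midpoint_primitive u' x * deriv \<phi> x)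
        = (LINT t|leb_interval. u' t * (LINT s|leb_interval. oriented t s * deriv \<phi> s))"
      by (rule midpoint_primitive_mult(3)[OF u' integrable_continuous_leb_interval[OF c]])
    also have "\<dots> = (LINT t|leb_interval. - (u' t * \<phi> t))"
      by (intro Bochner_Integration.integral_cong refl) (simp add: inner)
    also have "\<dots> = (LINT x|leb_interval. u x * deriv \<phi> x)"
      using assms \<phi> by (simp add: W12_with_derivative_def has_weak_derivative_on_def)
    finally show ?thesis
      using integrable_mult_continuous[OF u c] integrable_mult_continuous[OF U c]
      by (simp add: left_diff_distrib)
  qed
  then obtain K where "AE x in leb_interval. u x - midpoint_primitive u' x = K"
    using du_Bois_Reymond[of "-1" 1 "\<lambda>x. u x - midpoint_primitive u' x"] u U by auto
  then have "AE x in leb_interval. u x = midpoint_primitive u' x + K"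
    by eventually_elim simp
  then show thesis by (rule that)
qed


section \<open>The sharp Wirtinger inequality\<close>

text \<open>
  Schur's test with the weights \<open>p t = cos (pi * t / 2)\<close> and \<open>w s = \<bar>sin (pi * s / 2)\<bar>\<close>. They are
  the derivative and the modulus of the extremal function up to constants, which is what makes the
  bound sharp. Integrating \<open>A + B\<close> below first over the variable of the weight in the numerator
  replaces that weight by \<open>2 / pi\<close> times the other one, and the quotients cancel.
\<close>

lemma oriented_Schur_bound:
  assumes f: "f \<in> L2_on {-1<..<1}" and g: "g \<in> L2_on {-1<..<1}"
  shows "2 * (LINT p|(leb_interval \<Otimes>\<^sub>M leb_interval). \<bar>oriented (fst p) (snd p) * f (fst p) * g (snd p)\<bar>)
    \<le> (2 / pi)\<^sup>2 * (LINT x|leb_interval. (f x)\<^sup>2) + (LINT x|leb_interval. (g x)\<^sup>2)"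
proof -
  let ?M = leb_interval
  define c where "c = 2 / pi"
  have "c > 0" by (simp add: c_def)
  define p where "p t = cos (pi * t / 2)" for t
  define w where "w s = \<bar>sin (pi * s / 2)\<bar>" for s
  have mf [measurable]: "f \<in> borel_measurable ?M" and mg [measurable]: "g \<in> borel_measurable ?M"
    using f g by (auto simp: L2_on_def)
  have f2: "integrable ?M (\<lambda>x. (f x)\<^sup>2)" and g2: "integrable ?M (\<lambda>x. (g x)\<^sup>2)"
    using f g by (auto simp: L2_on_def)
  have [measurable]: "p \<in> borel_measurable ?M" "w \<in> borel_measurable ?M"
    unfolding p_def w_def by measurable
  have p_pos: "p t > 0" if "t \<in> {-1<..<1}" for t
    unfolding p_def using that mult_strict_left_mono[of t 1 pi] mult_strict_left_mono[of "-1" t pi]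
    by (intro cos_gt_zero_pi) auto
  have sin_pos: "sin (pi * s / 2) > 0" if "0 < s" "s < 1" for s
    using that by (intro sin_gt_zero) auto
  have sin_neg: "sin (pi * s / 2) < 0" if "-1 < s" "s < 0" for s
    using sin_pos[of "- s"] that by simp
  have w_pos: "w s > 0" if "s \<in> {-1<..<1}" "s \<noteq> 0" for s
    using that sin_pos[of s] sin_neg[of s] by (cases "s > 0") (auto simp: w_def)
  have mk [measurable]: "(\<lambda>s. oriented t s) \<in> borel_measurable ?M" "(\<lambda>t. oriented t s) \<in> borel_measurable ?M" for t s
    unfolding oriented_def by measurable
  have w_kernel: "(\<integral>\<^sup>+s. ennreal (\<bar>oriented t s\<bar> * w s) \<partial>?M) = ennreal (c * p t)" if t: "t \<in> {-1<..<1}" for t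
  proof -
    have eq: "\<bar>oriented t s\<bar> * w s = oriented t s * sin (pi * s / 2)" if "s \<in> space ?M" for s
      using that t sin_pos[of s] sin_neg[of s] by (auto simp: oriented_def w_def)
    have F: "((\<lambda>s. - (c * cos (pi * s / 2))) has_real_derivative sin (pi * s / 2)) (at s)" for s
      by (auto intro!: derivative_eq_intros simp: c_def)
    have "continuous_on UNIV (\<lambda>s. sin (pi * s / 2))" by (intro continuous_intros) simp
    note I = oriented_integral_snd[OF t F this]
    have "(\<integral>\<^sup>+s. ennreal (\<bar>oriented t s\<bar> * w s) \<partial>?M) = (\<integral>\<^sup>+s. ennreal (oriented t s * sin (pi * s / 2)) \<partial>?M)"
      by (intro nn_integral_cong) (simp only: eq)
    also have "\<dots> = ennreal (LINT s|?M. oriented t s * sin (pi * s / 2))"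
    proof (rule nn_integral_eq_integral[OF I(1)], rule AE_I2)
      fix s assume "s \<in> space ?M"
      from eq[OF this, symmetric] show "0 \<le> oriented t s * sin (pi * s / 2)" by (simp add: w_def)
    qed
    also have "\<dots> = ennreal (c * p t)"
      unfolding I(2) by (simp add: p_def)
    finally show ?thesis .
  qed
  have p_kernel: "(\<integral>\<^sup>+t. ennreal (\<bar>oriented t s\<bar> * p t) \<partial>?M) = ennreal (c * w s)" if s: "s \<in> {-1<..<1}" for s
  proof -
    \<comment> \<open>\<open>\<sigma>\<close> is the sign of \<open>oriented t s\<close> as a function of \<open>t\<close>, where it does not vanish.\<close>
    define \<sigma> :: real where "\<sigma> = (if 0 \<le> s then 1 else -1)"
    have eq: "\<bar>oriented t s\<bar> * p t = oriented t s * (\<sigma> * p t)" for t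
      by (auto simp: oriented_def \<sigma>_def)
    have F: "((\<lambda>t. \<sigma> * (c * sin (pi * t / 2))) has_real_derivative \<sigma> * p t) (at t)" for t
      by (auto intro!: derivative_eq_intros simp: c_def p_def)
    have "continuous_on UNIV (\<lambda>t. \<sigma> * p t)" unfolding p_def by (intro continuous_intros) simp
    note I = oriented_integral_fst[OF s F this]
    have "(\<integral>\<^sup>+t. ennreal (\<bar>oriented t s\<bar> * p t) \<partial>?M) = (\<integral>\<^sup>+t. ennreal (oriented t s * (\<sigma> * p t)) \<partial>?M)"
      by (simp only: eq)
    also have "\<dots> = ennreal (LINT t|?M. oriented t s * (\<sigma> * p t))"
      using p_pos by (intro nn_integral_eq_integral[OF I(1)] AE_I2) (simp flip: eq add: less_imp_le)
    also have "\<dots> = ennreal (c * w s)"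
      using sin_pos[of s] sin_neg[of s] s unfolding I(2) by (cases "s = 0") (auto simp: \<sigma>_def w_def)
    finally show ?thesis .
  qed
  define k where "k q = \<bar>oriented (fst q) (snd q)\<bar>" for q
  define A where "A q = k q * (c * w (snd q) / p (fst q) * (f (fst q))\<^sup>2)" for q
  define B where "B q = k q * (p (fst q) / (c * w (snd q)) * (g (snd q))\<^sup>2)" for q
  have [measurable]: "k \<in> borel_measurable (?M \<Otimes>\<^sub>M ?M)"
    using borel_measurable_oriented unfolding k_def by (auto simp: case_prod_unfold)
  have [measurable]: "A \<in> borel_measurable (?M \<Otimes>\<^sub>M ?M)" "B \<in> borel_measurable (?M \<Otimes>\<^sub>M ?M)"
    unfolding A_def B_def by measurable
  have A_int: "(\<integral>\<^sup>+q. ennreal (A q) \<partial>(?M \<Otimes>\<^sub>M ?M)) = ennreal (c\<^sup>2 * (LINT x|?M. (f x)\<^sup>2))"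
  proof -
    have "(\<integral>\<^sup>+q. ennreal (A q) \<partial>(?M \<Otimes>\<^sub>M ?M)) = (\<integral>\<^sup>+t. (\<integral>\<^sup>+s. ennreal (A (t, s)) \<partial>?M) \<partial>?M)"
      by (subst leb_interval.nn_integral_fst[symmetric]) auto
    also have "\<dots> = (\<integral>\<^sup>+t. ennreal (c\<^sup>2 * (f t)\<^sup>2) \<partial>?M)"
    proof (intro nn_integral_cong)
      fix t assume "t \<in> space ?M"
      then have t: "t \<in> {-1<..<1}" by simp
      have "(\<integral>\<^sup>+s. ennreal (A (t, s)) \<partial>?M) = (\<integral>\<^sup>+s. ennreal (c / p t * (f t)\<^sup>2) * ennreal (\<bar>oriented t s\<bar> * w s) \<partial>?M)"
        using p_pos[OF t] \<open>c > 0\<close>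
        by (intro nn_integral_cong) (simp add: A_def k_def w_def ennreal_mult[symmetric] mult_ac)
      also have "\<dots> = ennreal (c / p t * (f t)\<^sup>2) * ennreal (c * p t)"
        by (subst nn_integral_cmult) (use w_kernel[OF t] in auto)
      also have "\<dots> = ennreal (c\<^sup>2 * (f t)\<^sup>2)"
        using p_pos[OF t] \<open>c > 0\<close> by (simp add: ennreal_mult[symmetric] power2_eq_square mult_ac)
      finally show "(\<integral>\<^sup>+s. ennreal (A (t, s)) \<partial>?M) = ennreal (c\<^sup>2 * (f t)\<^sup>2)" .
    qed
    also have "\<dots> = ennreal (c\<^sup>2 * (LINT x|?M. (f x)\<^sup>2))"
      using f2 by (subst nn_integral_eq_integral) auto
    finally show ?thesis .
  qed
  have B_int: "(\<integral>\<^sup>+q. ennreal (B q) \<partial>(?M \<Otimes>\<^sub>M ?M)) \<le> ennreal (LINT x|?M. (g x)\<^sup>2)"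
  proof -
    have "(\<integral>\<^sup>+q. ennreal (B q) \<partial>(?M \<Otimes>\<^sub>M ?M)) = (\<integral>\<^sup>+s. (\<integral>\<^sup>+t. ennreal (B (t, s)) \<partial>?M) \<partial>?M)"
      by (rule leb_square.nn_integral_snd[symmetric]) auto
    also have "\<dots> \<le> (\<integral>\<^sup>+s. ennreal ((g s)\<^sup>2) \<partial>?M)"
    proof (intro nn_integral_mono)
      fix s assume "s \<in> space ?M"
      then have s: "s \<in> {-1<..<1}" by simp
      have "(\<integral>\<^sup>+t. ennreal (B (t, s)) \<partial>?M) = (\<integral>\<^sup>+t. ennreal ((g s)\<^sup>2 / (c * w s)) * ennreal (\<bar>oriented t s\<bar> * p t) \<partial>?M)"
        using p_pos \<open>c > 0\<close>
        by (intro nn_integral_cong) (simp add: B_def k_def w_def ennreal_mult[symmetric] mult_ac less_imp_le)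
      also have "\<dots> = ennreal ((g s)\<^sup>2 / (c * w s)) * ennreal (c * w s)"
        by (subst nn_integral_cmult) (use p_kernel[OF s] in auto)
      also have "\<dots> \<le> ennreal ((g s)\<^sup>2)"
        \<comment> \<open>At \<open>s = 0\<close> the weight \<open>w\<close> vanishes and the left side is zero by the convention \<open>x / 0 = 0\<close>.\<close>
        using \<open>c > 0\<close> by (cases "w s = 0") (simp_all add: w_def ennreal_mult[symmetric])
      finally show "(\<integral>\<^sup>+t. ennreal (B (t, s)) \<partial>?M) \<le> ennreal ((g s)\<^sup>2)" .
    qed
    also have "\<dots> = ennreal (LINT x|?M. (g x)\<^sup>2)"
      using g2 by (rule nn_integral_eq_integral) simp
    finally show ?thesis .
  qed
  define F where "F q = oriented (fst q) (snd q) * f (fst q) * g (snd q)" for q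
  have F: "integrable (?M \<Otimes>\<^sub>M ?M) F"
    using integrable_oriented_product[OF L2_on_integrable[OF f] L2_on_integrable[OF g]]
    by (simp add: F_def[abs_def] case_prod_unfold)
  have amgm: "2 * \<bar>F (t, s)\<bar> \<le> A (t, s) + B (t, s)" if t: "t \<in> {-1<..<1}" and s: "s \<in> {-1<..<1}" for t s
  proof (cases "oriented t s = 0")
    case True
    then show ?thesis by (simp add: F_def A_def B_def k_def)
  next
    case False
    then have "s \<noteq> 0" by (auto simp: oriented_def split: if_splits)
    have k1: "\<bar>oriented t s\<bar> = 1" using False by (auto simp: oriented_def split: if_splits)
    \<comment> \<open>Young's inequality, balanced by the quotient of the weights.\<close>
    define r where "r = c * w s / p t"
    have "r > 0" using p_pos[OF t] w_pos[OF s \<open>s \<noteq> 0\<close>] \<open>c > 0\<close> by (simp add: r_def)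
    have "2 * (sqrt r * \<bar>f t\<bar>) * (\<bar>g s\<bar> / sqrt r) \<le> (sqrt r * \<bar>f t\<bar>)\<^sup>2 + (\<bar>g s\<bar> / sqrt r)\<^sup>2"
      by (rule sum_squares_bound)
    also have "2 * (sqrt r * \<bar>f t\<bar>) * (\<bar>g s\<bar> / sqrt r) = 2 * (\<bar>f t\<bar> * \<bar>g s\<bar>)"
      using \<open>r > 0\<close> by simp
    also have "(sqrt r * \<bar>f t\<bar>)\<^sup>2 + (\<bar>g s\<bar> / sqrt r)\<^sup>2 = r * (f t)\<^sup>2 + (g s)\<^sup>2 / r"
      using \<open>r > 0\<close> by (simp add: power_mult_distrib power_divide)
    finally show ?thesis
      by (simp add: F_def A_def B_def k_def k1 abs_mult r_def mult_ac)
  qed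
  have "ennreal (2 * (LINT q|(?M \<Otimes>\<^sub>M ?M). \<bar>F q\<bar>)) = (\<integral>\<^sup>+q. ennreal (2 * \<bar>F q\<bar>) \<partial>(?M \<Otimes>\<^sub>M ?M))"
    using F by (subst nn_integral_eq_integral) auto
  also have "\<dots> \<le> (\<integral>\<^sup>+q. ennreal (A q) + ennreal (B q) \<partial>(?M \<Otimes>\<^sub>M ?M))"
  proof (intro nn_integral_mono)
    fix q assume "q \<in> space (?M \<Otimes>\<^sub>M ?M)"
    then obtain t s where q: "q = (t, s)" "t \<in> {-1<..<1}" "s \<in> {-1<..<1}"
      by (auto simp: space_pair_measure)
    have "A q \<ge> 0" "B q \<ge> 0"
      using p_pos[OF q(2)] \<open>c > 0\<close> by (auto simp: q A_def B_def k_def w_def)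
    then show "ennreal (2 * \<bar>F q\<bar>) \<le> ennreal (A q) + ennreal (B q)"
      using amgm[OF q(2,3)] by (simp add: q(1) ennreal_plus[symmetric] ennreal_leI del: ennreal_plus)
  qed
  also have "\<dots> = (\<integral>\<^sup>+q. ennreal (A q) \<partial>(?M \<Otimes>\<^sub>M ?M)) + (\<integral>\<^sup>+q. ennreal (B q) \<partial>(?M \<Otimes>\<^sub>M ?M))"
    by (rule nn_integral_add) auto
  also have "\<dots> \<le> ennreal (c\<^sup>2 * (LINT x|?M. (f x)\<^sup>2)) + ennreal (LINT x|?M. (g x)\<^sup>2)"
    unfolding A_int using B_int by (rule add_left_mono)
  also have "\<dots> = ennreal (c\<^sup>2 * (LINT x|?M. (f x)\<^sup>2) + (LINT x|?M. (g x)\<^sup>2))"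
    by (rule ennreal_plus[symmetric]) auto
  finally show ?thesis
    unfolding F_def c_def by (subst (asm) ennreal_le_iff) auto
qed

lemma Wirtinger_inequality:
  assumes W: "(u, u') \<in> W12_with_derivative {-1<..<1}" and mean: "(LINT x|leb_interval. u x) = 0"
  shows "(LINT x|leb_interval. (u x)\<^sup>2) \<le> (2 / pi)\<^sup>2 * (LINT x|leb_interval. (u' x)\<^sup>2)"
proof -
  have u: "u \<in> L2_on {-1<..<1}" and u': "u' \<in> L2_on {-1<..<1}"
    using W by (auto simp: W12_with_derivative_def)
  note iu = L2_on_integrable[OF u] and iu' = L2_on_integrable[OF u']
  obtain K where K: "AE x in leb_interval. u x = midpoint_primitive u' x + K"
    using weakly_differentiable_eq_midpoint_primitive[OF W] by blast
  have U: "integrable leb_interval (midpoint_primitive u')"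
    using midpoint_primitive_mult(1)[OF iu' leb_interval.integrable_const[of 1]] by simp
  have "(LINT x|leb_interval. (u x)\<^sup>2) = (LINT x|leb_interval. midpoint_primitive u' x * u x + K * u x)"
  proof (rule integral_cong_AE)
    show "AE x in leb_interval. (u x)\<^sup>2 = midpoint_primitive u' x * u x + K * u x"
      using K by eventually_elim (simp add: power2_eq_square distrib_right)
  qed (use U iu in \<open>auto intro!: borel_measurable_add borel_measurable_times\<close>)
  also have "\<dots> = (LINT x|leb_interval. midpoint_primitive u' x * u x)"
    using midpoint_primitive_mult(1)[OF iu' iu] iu mean by simp
  also have "\<dots> = (LINT p|(leb_interval \<Otimes>\<^sub>M leb_interval). oriented (fst p) (snd p) * u' (fst p) * u (snd p))"
    by (rule midpoint_primitive_mult(2)[OF iu' iu])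
  also have "\<dots> \<le> (LINT p|(leb_interval \<Otimes>\<^sub>M leb_interval). \<bar>oriented (fst p) (snd p) * u' (fst p) * u (snd p)\<bar>)"
    using integrable_oriented_product[OF iu' iu]
    by (intro integral_mono) (auto simp: case_prod_unfold)
  finally show ?thesis
    using oriented_Schur_bound[OF u' u] by linarith
qed

lemma sine_minimizer:
  defines "u \<equiv> \<lambda>x. sin (pi * x / 2)" and "u' \<equiv> \<lambda>x. pi / 2 * cos (pi * x / 2)"
  shows "(u, u') \<in> W12_with_derivative {-1<..<1}"
    and "(LINT x|leb_interval. (u x)\<^sup>2) = 1"
    and "(LINT x|leb_interval. u x) = 0"
    and "(LINT x|leb_interval. \<bar>u' x\<bar>\<^sup>2) = pi\<^sup>2 / 4"
proof -
  have FTC: "(LINT x|leb_interval. f x) = F 1 - F (-1)"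
    if "\<And>x. (F has_real_derivative f x) (at x)" "continuous_on UNIV f" for F f
  proof -
    have "{-1<..<1} \<subseteq> {-1..1::real}" by auto
    note I = integral_derivative_between(2)[OF _ _ _ that order_refl this]
    have "(LINT x|leb_interval. indicator {-1<..<1} x * f x) = (LINT x|leb_interval. f x)"
      by (rule Bochner_Integration.integral_cong) auto
    then show ?thesis using I by simp
  qed
  have cu: "continuous_on UNIV u" and cu': "continuous_on UNIV u'"
    unfolding u_def u'_def by (intro continuous_intros; simp)+
  have du: "(u has_real_derivative u' x) (at x)" for x
    unfolding u_def u'_def by (auto intro!: derivative_eq_intros)
  have "(LINT x|leb_interval. u x * deriv \<phi> x) = - (LINT x|leb_interval. u' x * \<phi> x)"
    if \<phi>: "\<phi> \<in> test_functions {-1<..<1}" for \<phi>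
  proof -
    note smooth = test_function_smooth[OF \<phi>]
    note c = smooth_continuous_on[OF smooth_deriv[OF smooth]] smooth_continuous_on[OF smooth]
    have "(LINT x|leb_interval. u x * deriv \<phi> x + u' x * \<phi> x) = u 1 * \<phi> 1 - u (-1) * \<phi> (-1)"
      by (intro FTC) (auto intro!: derivative_eq_intros du smooth_has_derivative[OF smooth] continuous_intros cu cu' c)
    then show ?thesis
      using test_function_zero[OF \<phi>, of 1] test_function_zero[OF \<phi>, of "-1"]
        integrable_continuous_leb_interval[OF continuous_on_mult[OF cu c(1)]]
        integrable_continuous_leb_interval[OF continuous_on_mult[OF cu' c(2)]]
      by simp
  qed
  then show "(u, u') \<in> W12_with_derivative {-1<..<1}"
    using cu cu' unfolding W12_with_derivative_def has_weak_derivative_on_def L2_on_def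
    by (auto intro!: continuous_borel_measurable_leb_interval integrable_continuous_leb_interval continuous_intros)
  have double: "cos (pi * x) = 1 - 2 * (sin (pi * x / 2))\<^sup>2" for x
    using cos_double_sin[of "pi * x / 2"] by simp
  have cc: "continuous_on UNIV (\<lambda>x. cos (pi * x))" by (intro continuous_intros)
  have "(LINT x|leb_interval. (u x)\<^sup>2) = (LINT x|leb_interval. 1 / 2 - cos (pi * x) / 2)"
    by (simp add: u_def double diff_divide_distrib)
  also have "\<dots> = (1 / 2 - sin (pi * 1) / (2 * pi)) - ((-1) / 2 - sin (pi * (-1)) / (2 * pi))"
    by (rule FTC) (auto intro!: derivative_eq_intros continuous_intros cc)
  finally show "(LINT x|leb_interval. (u x)\<^sup>2) = 1" by simp
  show "(LINT x|leb_interval. u x) = 0"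
  proof -
    have "((\<lambda>x. - (2 / pi * cos (pi * x / 2))) has_real_derivative u x) (at x)" for x
      by (auto simp: u_def intro!: derivative_eq_intros)
    from FTC[OF this cu] show ?thesis by simp
  qed
  have "(LINT x|leb_interval. \<bar>u' x\<bar>\<^sup>2) = (LINT x|leb_interval. pi\<^sup>2 / 4 * (1 / 2 + cos (pi * x) / 2))"
    by (simp add: u'_def double power_mult_distrib power_divide cos_squared_eq diff_divide_distrib)
  also have "\<dots> = pi\<^sup>2 / 4 * (1 / 2 + sin (pi * 1) / (2 * pi)) - pi\<^sup>2 / 4 * ((-1) / 2 + sin (pi * (-1)) / (2 * pi))"
    by (rule FTC) (auto intro!: derivative_eq_intros continuous_intros cc)
  finally show "(LINT x|leb_interval. \<bar>u' x\<bar>\<^sup>2) = pi\<^sup>2 / 4" by simp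
qed


section \<open>A superposition of two graphs\<close>

text \<open>
  Finite Borel measures on a complete separable metric space are inner regular; this applies to the
  image measure on the whole space, which agrees with the one on \<open>S\<close> on the subsets of \<open>S\<close>.
\<close>

lemma pushforward_radon_measure_on:
  fixes g :: "'b \<Rightarrow> 'a::{second_countable_topology, complete_space}"
  assumes M: "finite_measure M" and g': "g \<in> M \<rightarrow>\<^sub>M restrict_space borel S"
    and S: "S \<in> sets borel"
  shows "radon_measure_on S (distr M (restrict_space borel S) g)"
proof -
  interpret finite_measure M by fact
  have g: "g \<in> M \<rightarrow>\<^sub>M borel"
    using g' by (simp add: measurable_restrict_space2_iff)
  interpret P: finite_measure "distr M borel g" by (rule finite_measure_distr[OF g])
  have eq: "emeasure (distr M (restrict_space borel S) g) A = emeasure (distr M borel g) A"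
    if "A \<in> sets (restrict_space borel S)" for A
  proof -
    have "A \<in> sets borel" using that S by (auto simp: sets_restrict_space_iff)
    then show ?thesis using that g g' by (simp add: emeasure_distr)
  qed
  have K: "K \<in> sets (restrict_space borel S)" if "compact K" "K \<subseteq> S" for K
    using that S by (auto simp: sets_restrict_space_iff borel_compact)
  show ?thesis
    unfolding radon_measure_on_def
  proof (intro conjI allI impI ballI)
    fix K assume "compact K \<and> K \<subseteq> S"
    then show "emeasure (distr M (restrict_space borel S) g) K < \<infinity>"
      using K[of K] by (simp add: eq P.emeasure_finite less_top[symmetric])
  next
    fix A assume A: "A \<in> sets (distr M (restrict_space borel S) g)"
    then have "A \<in> sets borel" "A \<subseteq> S"
      using S by (auto simp: sets_restrict_space_iff)
    then have "emeasure (distr M borel g) A = (SUP K\<in>{K. K \<subseteq> A \<and> compact K}. emeasure (distr M borel g) K)"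
      by (intro inner_regular) (auto simp: P.emeasure_finite)
    also have "\<dots> = (SUP K\<in>{K. K \<subseteq> A \<and> compact K}. emeasure (distr M (restrict_space borel S) g) K)"
      using K \<open>A \<subseteq> S\<close> by (intro SUP_cong refl) (auto simp: eq)
    finally show "emeasure (distr M (restrict_space borel S) g) A
      = (SUP K\<in>{K. K \<subseteq> A \<and> compact K}. emeasure (distr M (restrict_space borel S) g) K)"
      using A by (simp add: eq)
  qed simp
qed

definition two_values :: "real measure" where
  "two_values = point_measure {- 1 / sqrt 2, 1 / sqrt 2} (\<lambda>_. ennreal (1 / 2))"

text \<open>
  The average of the occupation measures of the two constant functions \<open>- 1 / sqrt 2\<close> and
  \<open>1 / sqrt 2\<close>, whose gradient \<open>z\<close> is \<open>0\<close>; \<open>superposed_boundary_values\<close> is the average of their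
  boundary measures.
\<close>

definition superposed_graphs :: "(real \<times> real \<times> real) measure" where
  "superposed_graphs =
     distr (two_values \<Otimes>\<^sub>M restrict_space lborel {-1..1})
       (restrict_space borel ({-1..1} \<times> UNIV \<times> UNIV)) (\<lambda>(y, x). (x, y, 0))"

definition superposed_boundary_values :: "(real \<times> real) measure" where
  "superposed_boundary_values =
     distr (point_measure ({-1, 1} \<times> {- 1 / sqrt 2, 1 / sqrt 2}) (\<lambda>_. ennreal (1 / 2)))
       (restrict_space borel ({-1, 1} \<times> UNIV)) (\<lambda>p. p)"

lemma sets_two_values: "sets two_values = sets (count_space {- 1 / sqrt 2, 1 / sqrt 2})"
  by (simp add: two_values_def sets_point_measure)

lemma finite_measure_two_values: "finite_measure two_values"
  by (rule finite_measureI) (simp add: two_values_def space_point_measure emeasure_point_measure_finite ennreal_mult_eq_top_iff)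

lemma finite_measure_lborel_Icc: "finite_measure (restrict_space lborel {-1..1::real})"
  by (rule finite_measureI) (simp add: space_restrict_space emeasure_restrict_space)

lemma integral_lborel_Icc:
  fixes h :: "real \<Rightarrow> real"
  assumes "continuous_on {-1..1} h"
  shows "(LINT x|restrict_space lborel {-1..1}. h x) = integral {-1..1} h"
  using set_borel_integral_eq_integral(2)[OF borel_integrable_atLeastAtMost'[OF assms]]
  by (simp add: integral_restrict_space set_lebesgue_integral_def)

lemma borel_measurable_two_values_pair:
  fixes h :: "real \<times> real \<Rightarrow> 'c::topological_space"
  assumes "\<And>y. continuous_on {-1..1} (\<lambda>x. h (y, x))"
  shows "h \<in> borel_measurable (two_values \<Otimes>\<^sub>M restrict_space lborel {-1..1})"
proof -
  have sN: "sets (restrict_space lborel {-1..1::real}) = sets (restrict_space borel {-1..1})"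
    by (rule sets_restrict_space_cong) simp
  have sP: "sets (two_values \<Otimes>\<^sub>M restrict_space lborel {-1..1::real})
      = sets (count_space {- 1 / sqrt 2, 1 / sqrt 2} \<Otimes>\<^sub>M restrict_space lborel {-1..1})"
    by (rule sets_pair_measure_cong[OF sets_two_values refl])
  show ?thesis
    using borel_measurable_continuous_on_restrict[OF assms]
    by (subst measurable_cong_sets[OF sP refl])
       (intro measurable_pair_measure_countable1, auto simp: measurable_cong_sets[OF sN refl])
qed

lemma space_two_values_pair:
  "space (two_values \<Otimes>\<^sub>M restrict_space lborel {-1..1}) = {- 1 / sqrt 2, 1 / sqrt 2} \<times> {-1..1}"
  by (simp add: space_pair_measure two_values_def space_point_measure space_restrict_space)

lemma measurable_lift_to_strip:
  "(\<lambda>(y, x). (x, y, 0)) \<in> two_values \<Otimes>\<^sub>M restrict_space lborel {-1..1::real}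
     \<rightarrow>\<^sub>M restrict_space borel ({-1..1} \<times> UNIV \<times> (UNIV::real set))"
  by (intro measurable_restrict_space2 borel_measurable_two_values_pair)
     (auto simp: space_two_values_pair intro!: continuous_intros)

lemma superposed_graphs_radon: "radon_measure_on ({-1..1} \<times> UNIV \<times> UNIV) superposed_graphs"
  unfolding superposed_graphs_def
proof (rule pushforward_radon_measure_on)
  show "finite_measure (two_values \<Otimes>\<^sub>M restrict_space lborel {-1..1::real})"
    by (rule finite_measure_pair_measure) (rule finite_measure_lborel_Icc finite_measure_two_values)+
qed (rule measurable_lift_to_strip, auto intro!: borel_closed closed_Times)

lemma superposed_graphs_integral:
  fixes f :: "real \<times> real \<times> real \<Rightarrow> real"
  assumes f: "f \<in> borel_measurable (restrict_space borel ({-1..1} \<times> UNIV \<times> UNIV))"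
    and c: "\<And>y. continuous_on {-1..1} (\<lambda>x. f (x, y, 0))"
  shows "integrable superposed_graphs f"
    and "integral\<^sup>L superposed_graphs f =
      (integral {-1..1} (\<lambda>x. f (x, - 1 / sqrt 2, 0)) + integral {-1..1} (\<lambda>x. f (x, 1 / sqrt 2, 0))) / 2"
proof -
  let ?N = "restrict_space lborel {-1..1::real}"
  let ?Y = "{- 1 / sqrt 2, 1 / sqrt 2 :: real}"
  note g = measurable_lift_to_strip
  interpret Y: finite_measure two_values by (rule finite_measure_two_values)
  interpret N: finite_measure ?N by (rule finite_measure_lborel_Icc)
  interpret P: pair_sigma_finite two_values ?N ..
  interpret PF: finite_measure "two_values \<Otimes>\<^sub>M ?N"
    by (rule finite_measure_pair_measure) (rule finite_measure_lborel_Icc finite_measure_two_values)+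
  have fg: "(\<lambda>(y, x). f (x, y, 0)) \<in> borel_measurable (two_values \<Otimes>\<^sub>M ?N)"
    by (rule borel_measurable_two_values_pair) (simp add: c)
  have "\<exists>B. \<forall>x\<in>{-1..1}. \<bar>f (x, y, 0)\<bar> \<le> B" for y
    using compact_imp_bounded[OF compact_continuous_image[OF c[of y] compact_Icc]]
    by (auto simp: bounded_iff)
  then obtain B where B: "\<And>x y. x \<in> {-1..1} \<Longrightarrow> \<bar>f (x, y, 0)\<bar> \<le> B y" by metis
  have int: "integrable (two_values \<Otimes>\<^sub>M ?N) (\<lambda>(y, x). f (x, y, 0))"
  proof (rule PF.integrable_const_bound[OF _ fg])
    show "AE p in two_values \<Otimes>\<^sub>M ?N. norm (case p of (y, x) \<Rightarrow> f (x, y, 0)) \<le> max (B (- 1 / sqrt 2)) (B (1 / sqrt 2))"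
      using B by (intro AE_I2) (force simp: space_two_values_pair le_max_iff_disj)
  qed
  then show "integrable superposed_graphs f"
    unfolding superposed_graphs_def by (subst integrable_distr_eq[OF g f]) (simp add: case_prod_unfold)
  have "integral\<^sup>L superposed_graphs f = integral\<^sup>L (two_values \<Otimes>\<^sub>M ?N) (\<lambda>(y, x). f (x, y, 0))"
    unfolding superposed_graphs_def by (subst integral_distr[OF g f]) (simp add: case_prod_unfold)
  also have "\<dots> = (LINT y|two_values. LINT x|?N. f (x, y, 0))"
    using P.integral_fst[OF int] by simp
  also have "\<dots> = (LINT y|two_values. integral {-1..1} (\<lambda>x. f (x, y, 0)))"
    by (simp add: integral_lborel_Icc c)
  also have "\<dots> = (\<Sum>y\<in>?Y. 1 / 2 * integral {-1..1} (\<lambda>x. f (x, y, 0)))"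
    unfolding two_values_def by (subst lebesgue_integral_point_measure_finite) auto
  finally show "integral\<^sup>L superposed_graphs f =
      (integral {-1..1} (\<lambda>x. f (x, - 1 / sqrt 2, 0)) + integral {-1..1} (\<lambda>x. f (x, 1 / sqrt 2, 0))) / 2"
    by (simp add: add_divide_distrib)
qed

lemma superposed_boundary_values_integral:
  fixes f :: "real \<times> real \<Rightarrow> real"
  assumes f: "f \<in> borel_measurable (restrict_space borel ({-1, 1} \<times> UNIV))"
  shows "integrable superposed_boundary_values f"
    and "integral\<^sup>L superposed_boundary_values f =
      (f (-1, - 1 / sqrt 2) + f (-1, 1 / sqrt 2) + f (1, - 1 / sqrt 2) + f (1, 1 / sqrt 2)) / 2"
proof -
  let ?E = "{-1, 1::real} \<times> {- 1 / sqrt 2, 1 / sqrt 2::real}"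
  have g: "(\<lambda>p. p) \<in> point_measure ?E (\<lambda>_. ennreal (1 / 2)) \<rightarrow>\<^sub>M restrict_space borel ({-1, 1} \<times> UNIV)"
    by (auto simp: measurable_point_measure_eq1 space_restrict_space)
  show "integrable superposed_boundary_values f"
    unfolding superposed_boundary_values_def
    by (subst integrable_distr_eq[OF g f]) (rule integrable_point_measure_finite, simp)
  have "integral\<^sup>L superposed_boundary_values f = (\<Sum>p\<in>?E. 1 / 2 * f p)"
    unfolding superposed_boundary_values_def
    by (subst integral_distr[OF g f], subst lebesgue_integral_point_measure_finite) auto
  also have "\<dots> = (f (-1, - 1 / sqrt 2) + f (-1, 1 / sqrt 2) + f (1, - 1 / sqrt 2) + f (1, 1 / sqrt 2)) / 2"
    by (simp add: sum.cartesian_product[symmetric] add_divide_distrib)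
  finally show "integral\<^sup>L superposed_boundary_values f =
      (f (-1, - 1 / sqrt 2) + f (-1, 1 / sqrt 2) + f (1, - 1 / sqrt 2) + f (1, 1 / sqrt 2)) / 2" .
qed

lemma superposed_boundary_values_radon: "radon_measure_on ({-1, 1} \<times> UNIV) superposed_boundary_values"
proof -
  have "finite_measure (point_measure ({-1, 1::real} \<times> {- 1 / sqrt 2, 1 / sqrt 2::real}) (\<lambda>_. ennreal (1 / 2)))"
    by (rule finite_measureI) (simp add: space_point_measure emeasure_point_measure_finite ennreal_mult_eq_top_iff)
  then show ?thesis
    unfolding superposed_boundary_values_def
    by (rule pushforward_radon_measure_on)
       (auto simp: space_restrict_space intro!: borel_closed closed_Times)
qed
text \<open>
  The transport equation is the fundamental theorem of calculus along each of the two horizontal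
  lines: since \<open>z = 0\<close>, only the derivative in \<open>x\<close> enters.
\<close>

lemma superposed_in_O2: "(superposed_graphs, superposed_boundary_values) \<in> O2"
proof -
  have m: "f \<in> borel_measurable (restrict_space borel ({-1..1} \<times> UNIV \<times> UNIV))"
    if "continuous_on ({-1..1} \<times> UNIV \<times> UNIV) f" for f :: "real \<times> real \<times> real \<Rightarrow> real"
    using that by (rule borel_measurable_continuous_on_restrict)
  have m2: "f \<in> borel_measurable (restrict_space borel ({-1, 1} \<times> UNIV))"
    if "continuous_on ({-1, 1} \<times> UNIV) f" for f :: "real \<times> real \<Rightarrow> real"
    using that by (rule borel_measurable_continuous_on_restrict)
  have moment: "integrable superposed_graphs (\<lambda>(x, y, z). 1 + \<bar>y\<bar>\<^sup>2 + \<bar>z\<bar>\<^sup>2)"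
    by (rule superposed_graphs_integral) (auto intro!: m continuous_intros simp: case_prod_unfold simp del: UNIV_Times_UNIV)
  have moment2: "integrable superposed_boundary_values (\<lambda>(x, y). 1 + \<bar>y\<bar>\<^sup>2)"
    by (rule superposed_boundary_values_integral) (auto intro!: m2 continuous_intros simp: case_prod_unfold simp del: UNIV_Times_UNIV)
  have mean: "(LINT (x, y, z)|superposed_graphs. y) = 0"
    by (subst superposed_graphs_integral) (auto intro!: m continuous_intros simp: case_prod_unfold simp del: UNIV_Times_UNIV)
  have "(1 / sqrt 2)\<^sup>2 = (1 / 2 :: real)" by (simp add: power_divide)
  then have norm: "(LINT (x, y, z)|superposed_graphs. y\<^sup>2) = 1"
    by (subst superposed_graphs_integral)
       (auto intro!: m continuous_intros simp: case_prod_unfold simp del: UNIV_Times_UNIV)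
  have x_marginal: "(LINT (x, y, z)|superposed_graphs. h x) = integral {-1..1} h"
    if "continuous_on {-1..1} h" for h :: "real \<Rightarrow> real"
  proof -
    have "continuous_on ({-1..1} \<times> UNIV \<times> UNIV) (\<lambda>p::real \<times> real \<times> real. h (fst p))"
      by (rule continuous_on_compose2[OF that]) (auto intro!: continuous_intros)
    then show ?thesis
      using that by (subst superposed_graphs_integral) (auto intro!: m simp: case_prod_unfold simp del: UNIV_Times_UNIV)
  qed
  have x_boundary: "(LINT (x, y)|superposed_boundary_values. l x) = l (-1) + l 1" for l :: "real \<Rightarrow> real"
  proof -
    have "continuous_on {-1, 1} l" by (rule continuous_on_finite) simp
    then have "continuous_on ({-1, 1} \<times> UNIV) (\<lambda>p::real \<times> real. l (fst p))"
      by (rule continuous_on_compose2) (auto intro!: continuous_intros)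
    then show ?thesis
      by (subst superposed_boundary_values_integral) (auto intro!: m2 simp: case_prod_unfold)
  qed
  have transport: "(LINT (x, y, z)|superposed_graphs. total_derivative \<phi> x y z)
      - (LINT (x, y)|superposed_boundary_values. x * \<phi> x y) = 0" if "\<phi> \<in> Phi2" for \<phi>
  proof -
    have \<phi>: "\<phi> \<in> C1_strip" using that by (simp add: Phi2_def)
    have d: "(\<lambda>s. \<phi> s y) differentiable (at x within {-1..1})" if "x \<in> {-1..1}" for x y
      using \<phi> that unfolding C1_strip_def by blast
    have c0: "continuous_on ({-1..1} \<times> UNIV) (\<lambda>p. \<phi> (fst p) (snd p))"
      and cx: "continuous_on ({-1..1} \<times> UNIV) (\<lambda>p. partial_x \<phi> (fst p) (snd p))"
      and cy: "continuous_on ({-1..1} \<times> UNIV) (\<lambda>p. partial_y \<phi> (fst p) (snd p))"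
      using \<phi> by (auto simp: C1_strip_def case_prod_unfold)
    have x_slice: "continuous_on {-1..1} (\<lambda>x. partial_x \<phi> x y)" for y
    proof -
      have "continuous_on {-1..1} (\<lambda>x. (x, y))" by (intro continuous_intros)
      from continuous_on_compose2[OF cx this] show ?thesis by auto
    qed
    have q: "continuous_on ({-1..1} \<times> UNIV \<times> UNIV) (\<lambda>p::real \<times> real \<times> real. (fst p, fst (snd p)))"
      by (intro continuous_intros)
    have q_image: "(\<lambda>p::real \<times> real \<times> real. (fst p, fst (snd p))) ` ({-1..1} \<times> UNIV \<times> UNIV) \<subseteq> {-1..1} \<times> UNIV"
      by auto
    have "continuous_on ({-1..1} \<times> UNIV \<times> UNIV) (\<lambda>p::real \<times> real \<times> real. partial_x \<phi> (fst p) (fst (snd p)))"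
      using continuous_on_compose2[OF cx q q_image] by simp
    moreover have "continuous_on ({-1..1} \<times> UNIV \<times> UNIV) (\<lambda>p::real \<times> real \<times> real. partial_y \<phi> (fst p) (fst (snd p)))"
      using continuous_on_compose2[OF cy q q_image] by simp
    ultimately have "continuous_on ({-1..1} \<times> UNIV \<times> UNIV) (\<lambda>(x, y, z). total_derivative \<phi> x y z)"
      unfolding total_derivative_def case_prod_unfold by (intro continuous_intros)
    note td = m[OF this]
    have "(LINT (x, y, z)|superposed_graphs. total_derivative \<phi> x y z)
      = (integral {-1..1} (\<lambda>x. partial_x \<phi> x (- 1 / sqrt 2)) + integral {-1..1} (\<lambda>x. partial_x \<phi> x (1 / sqrt 2))) / 2"
      by (subst superposed_graphs_integral[OF td]) (auto intro!: x_slice simp: total_derivative_def)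
    moreover have "integral {-1..1} (\<lambda>x. partial_x \<phi> x y) = \<phi> 1 y - \<phi> (-1) y" for y
      using d[of _ y]
      by (intro integral_unique fundamental_theorem_of_calculus)
         (auto simp: partial_x_def vector_derivative_works)
    moreover have "continuous_on ({-1, 1} \<times> UNIV) (\<lambda>(x, y). x * \<phi> x y)"
      unfolding case_prod_unfold
      by (intro continuous_intros continuous_on_subset[OF c0]) auto
    then have "(LINT (x, y)|superposed_boundary_values. x * \<phi> x y)
      = (- \<phi> (-1) (- 1 / sqrt 2) - \<phi> (-1) (1 / sqrt 2) + \<phi> 1 (- 1 / sqrt 2) + \<phi> 1 (1 / sqrt 2)) / 2"
      by (subst superposed_boundary_values_integral) (auto intro!: m2)
    ultimately show ?thesis by (simp add: field_simps)
  qed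
  show ?thesis
    unfolding O2_def
    using superposed_graphs_radon superposed_boundary_values_radon moment moment2 mean norm
      x_marginal x_boundary transport by simp
qed

lemma relaxed_minimum_zero: "is_minimum {LINT (x, y, z)|\<mu>. z\<^sup>2 | \<mu> \<nu>. (\<mu>, \<nu>) \<in> O2} 0"
  unfolding is_minimum_def
proof (intro conjI ballI)
  have "(LINT (x, y, z)|superposed_graphs. z\<^sup>2) = 0"
    by (subst superposed_graphs_integral)
       (auto intro!: borel_measurable_continuous_on_restrict continuous_intros simp: case_prod_unfold simp del: UNIV_Times_UNIV)
  then show "0 \<in> {LINT (x, y, z)|\<mu>. z\<^sup>2 | \<mu> \<nu>. (\<mu>, \<nu>) \<in> O2}"
    using superposed_in_O2 by force
next
  fix v assume "v \<in> {LINT (x, y, z)|\<mu>. z\<^sup>2 | \<mu> \<nu>. (\<mu>, \<nu>) \<in> O2}"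
  then show "0 \<le> v" by (auto intro!: Bochner_Integration.integral_nonneg)
qed


section \<open>The two minima\<close>

theorem proposition7p2:
  shows "is_minimum
           {LINT x|lebesgue_on {-1<..<1}. \<bar>u' x\<bar>\<^sup>2 | u u'.
              (u, u') \<in> W12_with_derivative {-1<..<1} \<and>
              (LINT x|lebesgue_on {-1<..<1}. (u x)\<^sup>2) = 1 \<and>
              (LINT x|lebesgue_on {-1<..<1}. u x) = 0}
           (pi\<^sup>2 / 4)
       \<and> is_minimum {LINT (x, y, z)|\<mu>. z\<^sup>2 | \<mu> \<nu>. (\<mu>, \<nu>) \<in> O2} 0"
proof
  show "is_minimum
           {LINT x|lebesgue_on {-1<..<1}. \<bar>u' x\<bar>\<^sup>2 | u u'.
              (u, u') \<in> W12_with_derivative {-1<..<1} \<and>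
              (LINT x|lebesgue_on {-1<..<1}. (u x)\<^sup>2) = 1 \<and>
              (LINT x|lebesgue_on {-1<..<1}. u x) = 0}
           (pi\<^sup>2 / 4)"
    unfolding is_minimum_def
  proof (intro conjI ballI)
    show "pi\<^sup>2 / 4 \<in> {LINT x|lebesgue_on {-1<..<1}. \<bar>u' x\<bar>\<^sup>2 | u u'.
              (u, u') \<in> W12_with_derivative {-1<..<1} \<and>
              (LINT x|lebesgue_on {-1<..<1}. (u x)\<^sup>2) = 1 \<and>
              (LINT x|lebesgue_on {-1<..<1}. u x) = 0}"
      using sine_minimizer by (intro CollectI exI conjI) (rule sine_minimizer(4)[symmetric])
  next
    fix v assume "v \<in> {LINT x|lebesgue_on {-1<..<1}. \<bar>u' x\<bar>\<^sup>2 | u u'.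
              (u, u') \<in> W12_with_derivative {-1<..<1} \<and>
              (LINT x|lebesgue_on {-1<..<1}. (u x)\<^sup>2) = 1 \<and>
              (LINT x|lebesgue_on {-1<..<1}. u x) = 0}"
    then obtain u u' where v: "v = (LINT x|leb_interval. \<bar>u' x\<bar>\<^sup>2)"
      and W: "(u, u') \<in> W12_with_derivative {-1<..<1}"
      and u: "(LINT x|leb_interval. (u x)\<^sup>2) = 1" "(LINT x|leb_interval. u x) = 0" by blast
    have "1 \<le> (2 / pi)\<^sup>2 * v"
      using Wirtinger_inequality[OF W u(2)] by (simp add: u(1) v)
    then show "pi\<^sup>2 / 4 \<le> v" by (simp add: power_divide field_simps)
  qed
qed (rule relaxed_minimum_zero)

end
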